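(* Let $\lambda=\langle0^{m_0},1^{m_1},\dots,s^{m_s}\rangle$ be a partition with $n=\sum_{r=0}^s m_r$ parts and $m_0\ge1$, let $x_1,\dots,x_n>0$, and set $M_r=m_r+\cdots+m_s$ for $1\le r\le s$ and $M_{s+1}=0$. For the multispecies PushTASEP with content $\lambda$, the current of species $j$, for $1\le j\le s$ with $m_j\ge1$, is given by $$\frac{s_{\langle1^{m_j-1},\,2^{M_{j+1}}\rangle}(x_1,\dots,x_n)}{e_{(M_j,\,M_{j+1})}(x_1,\dots,x_n)}.$$
   Context: **Content and configurations.** $\langle 0^{m_0},1^{m_1},\dots,s^{m_s}\rangle$ denotes the partition of length $n$ with exactly $m_r$ parts equal to $r$. $\Omega_\lambda$ is the set of all distinct rearrangements $\eta=(\eta_1,\dots,\eta_n)$ of $\lambda$. **Multispecies PushTASEP.** The sites $1,2,\dots,n$ are arranged clockwise on a ring (site $n$ is followed by site $1$). $\eta_j=r\ge1$ means that site $j$ holds a particle of species $r$; $\eta_j=0$ means that site $j$ is vacant. The process is the continuous-time Markov chain on $\Omega_\lambda$ in which a bell rings at each site $j$ independently at rate $1/x_j$. If site $j$ is vacant when its bell rings, nothing changes. Otherwise let $i_1=\eta_j$; this particle moves to the first site $j_2$ clockwise from $j$ with $i_2:=\eta_{j_2}<i_1$. If $i_2=0$ the jump is complete; otherwise the displaced particle of species $i_2$ moves to the first site $j_3$ clockwise from $j_2$ with $\eta_{j_3}<i_2$, and so on until a vacancy is filled. All these moves occur instantaneously (each particle travelling clockwise) and site $j$ is left vacant. The chain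 is irreducible. **Current.** The current of species $j$ is the expected number of particles of species $j$ per unit time that cross a given edge of the ring (say $(n,1)$) in stationarity; by particle conservation it is the same for all edges. **Symmetric functions.** $e_m(x_1,\dots,x_n)=\sum_{1\le i_1<\cdots<i_m\le n}x_{i_1}\cdots x_{i_m}$, $e_0=1$, $e_{(a,b)}=e_ae_b$. $s_\mu$ is the Schur polynomial, and $\langle1^b,2^a\rangle$ is the partition with $a$ parts equal to $2$ and $b$ parts equal to $1$. *)

theory Defs
  imports "HOL-Probability.Probability" "HOL-Combinatorics.Multiset_Permutations"
begin

text \<open>
  Sites are numbered from 0: a configuration is a list \<open>\<eta>\<close> of length \<open>n\<close>, \<open>\<eta> ! i\<close> is the species
  at site \<open>i < n\<close> (0 meaning vacant), and the clockwise neighbour of \<open>i\<close> is \<open>(i + 1) mod n\<close>.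
\<close>

definition content :: "(nat \<Rightarrow> nat) \<Rightarrow> nat \<Rightarrow> nat multiset" where
  "content m s = (\<Sum>r\<le>s. replicate_mset (m r) r)"

definition configs :: "(nat \<Rightarrow> nat) \<Rightarrow> nat \<Rightarrow> nat list set" where
  "configs m s = permutations_of_multiset (content m s)"

text \<open>The number of clockwise steps from site \<open>i\<close> to the first site holding a species below \<open>r\<close>.\<close>

definition jump_dist :: "nat list \<Rightarrow> nat \<Rightarrow> nat \<Rightarrow> nat" where
  "jump_dist \<eta> i r = (LEAST d. 0 < d \<and> \<eta> ! ((i + d) mod length \<eta>) < r)"

text \<open>
  The cascade started by a particle of species \<open>r\<close> leaving site \<open>i\<close>, as a list of moves
  (species, starting site, number of clockwise steps). The second test serves only to make the
  recursion terminate: it always succeeds for \<open>r > 0\<close> if \<open>\<eta>\<close> has a vacancy.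
\<close>

function cascade :: "nat list \<Rightarrow> nat \<Rightarrow> nat \<Rightarrow> (nat \<times> nat \<times> nat) list" where
  "cascade \<eta> r i =
     (if r = 0 then []
      else let d = jump_dist \<eta> i r; i' = (i + d) mod length \<eta> in
        if \<eta> ! i' < r then (r, i, d) # cascade \<eta> (\<eta> ! i') i' else [])"
  by pat_completeness auto
termination by (relation "Wellfounded.measure (\<lambda>(\<eta>, r, i). r)") auto

declare cascade.simps [simp del]

definition ring_bell :: "nat list \<Rightarrow> nat \<Rightarrow> nat list" where
  "ring_bell \<eta> j =
     (if \<eta> ! j = 0 then \<eta>
      else fold (\<lambda>(r, i, d) \<xi>. \<xi>[(i + d) mod length \<eta> := r]) (cascade \<eta> (\<eta> ! j) j) (\<eta>[j := 0]))"

text \<open>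
  The number of particles of species \<open>r\<close> crossing the edge from \<open>k\<close> to \<open>(k + 1) mod n\<close> when the
  bell at site \<open>j\<close> rings.
\<close>

definition crossings :: "nat list \<Rightarrow> nat \<Rightarrow> nat \<Rightarrow> nat \<Rightarrow> nat" where
  "crossings \<eta> j r k =
     length (filter (\<lambda>(r', i, d). r' = r \<and> k \<in> (\<lambda>t. (i + t) mod length \<eta>) ` {..<d})
               (cascade \<eta> (\<eta> ! j) j))"

definition rate :: "(nat \<Rightarrow> real) \<Rightarrow> nat list \<Rightarrow> nat list \<Rightarrow> real" where
  "rate x \<xi> \<eta> = (\<Sum>j | j < length \<xi> \<and> ring_bell \<xi> j = \<eta>. 1 / x j)"

definition stationary :: "(nat \<Rightarrow> nat) \<Rightarrow> nat \<Rightarrow> (nat \<Rightarrow> real) \<Rightarrow> nat list pmf \<Rightarrow> bool" where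
  "stationary m s x \<pi> \<longleftrightarrow>
     set_pmf \<pi> \<subseteq> configs m s \<and>
     (\<forall>\<eta>\<in>configs m s.
        (\<Sum>\<xi>\<in>configs m s - {\<eta>}. pmf \<pi> \<xi> * rate x \<xi> \<eta>) =
        pmf \<pi> \<eta> * (\<Sum>\<xi>\<in>configs m s - {\<eta>}. rate x \<eta> \<xi>))"

text \<open>
  In state \<open>\<eta>\<close>, particles of species \<open>r\<close> cross the edge \<open>k\<close> at the instantaneous rate obtained by
  weighting the crossings caused by each bell with the rate of that bell; the current is the mean of
  this under \<open>\<pi>\<close>.
\<close>

definition current :: "(nat \<Rightarrow> real) \<Rightarrow> nat list pmf \<Rightarrow> nat \<Rightarrow> nat \<Rightarrow> real" where
  "current x \<pi> r k =
     measure_pmf.expectation \<pi> (\<lambda>\<eta>. \<Sum>j<length \<eta>. 1 / x j * real (crossings \<eta> j r k))"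

definition esym :: "nat \<Rightarrow> (nat \<Rightarrow> real) \<Rightarrow> nat \<Rightarrow> real" where
  "esym n x k = (\<Sum>S | S \<subseteq> {..<n} \<and> card S = k. \<Prod>i\<in>S. x i)"

definition cells :: "nat list \<Rightarrow> (nat \<times> nat) set" where
  "cells \<mu> = {(a, b). a < length \<mu> \<and> b < \<mu> ! a}"

definition ssyt :: "nat \<Rightarrow> nat list \<Rightarrow> (nat \<times> nat \<Rightarrow> nat) set" where
  "ssyt n \<mu> = {T \<in> cells \<mu> \<rightarrow>\<^sub>E {..<n}.
     (\<forall>a b b'. b < b' \<and> (a, b') \<in> cells \<mu> \<longrightarrow> T (a, b) \<le> T (a, b')) \<and>
     (\<forall>a a' b. a < a' \<and> (a', b) \<in> cells \<mu> \<longrightarrow> T (a, b) < T (a', b))}"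

definition schur :: "nat \<Rightarrow> (nat \<Rightarrow> real) \<Rightarrow> nat list \<Rightarrow> real" where
  "schur n x \<mu> = (\<Sum>T\<in>ssyt n \<mu>. \<Prod>c\<in>cells \<mu>. x (T c))"

end

theory Submission
  imports Defs
begin

text \<open>
  Fix a species \<open>c\<close> and forget everything but the set \<open>S\<close> of sites whose species is at least \<open>c\<close>. A
  cascade started in \<open>S\<close> fills exactly the first site outside \<open>S\<close>, so \<open>S\<close> performs the single-species
  process with \<open>M c\<close> particles, whose unique stationary law is proportional to \<open>\<Prod>i\<in>S. x i\<close>. A bell at
  \<open>j\<close> makes one particle of species at least \<open>c\<close> cross the edge \<open>k\<close> iff all sites from \<open>j\<close> to \<open>k\<close> lie
  in \<open>S\<close>; removing \<open>j\<close> from \<open>S\<close> then cancels the rate and shows that the current of these particles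
  is \<open>e (M c - 1) / e (M c)\<close>. The current of species \<open>j\<close> is the difference for \<open>c = j\<close> and
  \<open>c = j + 1\<close>, and its numerator is the dual Jacobi--Trudi determinant of a two-column shape.
\<close>

subsection \<open>Clockwise distance and cascades\<close>

text \<open>Clockwise distance, with values from 0 to \<open>n - 1\<close> on sites. The case split,
  in place of a remainder, reduces statements about arcs to linear arithmetic.\<close>

definition cdist :: "nat \<Rightarrow> nat \<Rightarrow> nat \<Rightarrow> nat" where
  "cdist n i k = (if i \<le> k then k - i else n + k - i)"

lemma cdist_self [simp]: "cdist n i i = 0"
  by (simp add: cdist_def)

lemma cdist_less: "i < n \<Longrightarrow> k < n \<Longrightarrow> cdist n i k < n"
  by (auto simp: cdist_def)

lemma cdist_inj: "k < n \<Longrightarrow> l < n \<Longrightarrow> i < n \<Longrightarrow> cdist n i k = cdist n i l \<Longrightarrow> k = l"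
  by (auto simp: cdist_def split: if_splits)

lemma cdist_inj_left: "k < n \<Longrightarrow> l < n \<Longrightarrow> i < n \<Longrightarrow> cdist n k i = cdist n l i \<Longrightarrow> k = l"
  by (auto simp: cdist_def split: if_splits)

text \<open>Walking on from \<open>w\<close> to \<open>k\<close> either completes the arc from
  \<open>i\<close> to \<open>k\<close> or, when \<open>w\<close> lies beyond \<open>k\<close>, adds
  one full turn.\<close>

lemma cdist_split:
  assumes "i < n" "w < n" "k < n"
  shows "cdist n i w + cdist n w k = (if cdist n i w \<le> cdist n i k then cdist n i k else n + cdist n i k)"
  using assms by (auto simp: cdist_def)

text \<open>Passes from distances measured from the start \<open>j\<close> of an arc to distances
  measured to its end \<open>k\<close>: \<open>next_free\<close> minimises the former,
  \<open>prev_free\<close> the latter. The start needs its own disjunct because the inequality on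
  the right is strict.\<close>

lemma cdist_between:
  assumes "j < n" "i < n" "k < n"
  shows "cdist n j i \<le> cdist n j k \<longleftrightarrow> i = j \<or> cdist n i k < cdist n j k"
proof (cases "i = j")
  case False
  then have "cdist n j i \<noteq> 0"
    using cdist_inj[of i n j j] assms by auto
  then show ?thesis
    using cdist_split[OF assms] cdist_less[OF assms(1,2)] False by (auto split: if_splits)
qed simp

lemma add_cdist_mod: "i < n \<Longrightarrow> k < n \<Longrightarrow> (i + cdist n i k) mod n = k"
  by (auto simp: cdist_def)

lemma cdist_add_mod:
  assumes "i < n" "d < n"
  shows "cdist n i ((i + d) mod n) = d"
proof (cases "i + d < n")
  case False
  then have "(i + d) mod n = i + d - n"
    using assms by (simp add: le_mod_geq)
  then show ?thesis
    using assms False by (auto simp: cdist_def)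
qed (auto simp: cdist_def)

lemma arc_iff:
  assumes "i < n" "d \<le> n" "k < n"
  shows "k \<in> (\<lambda>t. (i + t) mod n) ` {..<d} \<longleftrightarrow> cdist n i k < d"
proof
  assume "k \<in> (\<lambda>t. (i + t) mod n) ` {..<d}"
  then show "cdist n i k < d"
    using assms by (auto simp: cdist_add_mod)
next
  assume "cdist n i k < d"
  then show "k \<in> (\<lambda>t. (i + t) mod n) ` {..<d}"
    using assms add_cdist_mod[of i n k] by (intro image_eqI[of _ _ "cdist n i k"]) auto
qed

text \<open>The search includes \<open>i\<close> itself, at distance 0. If \<open>S\<close> contains
  every site the value is arbitrary, so the lemmas about it ask for a free site.\<close>

definition next_free :: "nat \<Rightarrow> nat set \<Rightarrow> nat \<Rightarrow> nat" where
  "next_free n S i = (ARG_MIN (cdist n i) w. w < n \<and> w \<notin> S)"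

lemma next_free:
  assumes "\<exists>w<n. w \<notin> S"
  shows "next_free n S i < n" "next_free n S i \<notin> S"
    and "\<And>k. k < n \<Longrightarrow> cdist n i k < cdist n i (next_free n S i) \<Longrightarrow> k \<in> S"
proof -
  obtain w where "w < n \<and> w \<notin> S"
    using assms by blast
  from arg_min_nat_lemma[of "\<lambda>w. w < n \<and> w \<notin> S", OF this, of "cdist n i"]
  show "next_free n S i < n" "next_free n S i \<notin> S"
    and "\<And>k. k < n \<Longrightarrow> cdist n i k < cdist n i (next_free n S i) \<Longrightarrow> k \<in> S"
    unfolding next_free_def by (auto simp: not_le[symmetric])
qed

lemma next_free_eqI:
  assumes "i < n" "w < n" "w \<notin> S"
    and "\<And>k. k < n \<Longrightarrow> cdist n i k < cdist n i w \<Longrightarrow> k \<in> S"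
  shows "next_free n S i = w"
proof -
  have ex: "\<exists>w<n. w \<notin> S"
    using assms by blast
  note nf = next_free[OF ex, where i = i]
  have "cdist n i (next_free n S i) = cdist n i w"
    using nf(1,2) nf(3)[OF assms(2)] assms(3) assms(4)[OF nf(1)] by linarith
  then show ?thesis
    using cdist_inj nf(1) assms(1,2) by blast
qed

definition push :: "nat \<Rightarrow> nat set \<Rightarrow> nat \<Rightarrow> nat set" where
  "push n S j = (if j \<in> S then insert (next_free n S j) (S - {j}) else S)"

text \<open>A particle leaving \<open>j\<close> passes the edge after \<open>k\<close> iff its
  landing site, the first one outside \<open>S\<close>, lies beyond \<open>k\<close>. The arc
  includes \<open>j\<close>, so a bell at a vacancy contributes nothing.\<close>

definition crosses :: "nat \<Rightarrow> nat set \<Rightarrow> nat \<Rightarrow> nat \<Rightarrow> bool" where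
  "crosses n S j k \<longleftrightarrow> (\<forall>i<n. cdist n j i \<le> cdist n j k \<longrightarrow> i \<in> S)"

definition above :: "nat \<Rightarrow> nat list \<Rightarrow> nat set" where
  "above c \<eta> = {p. p < length \<eta> \<and> c \<le> \<eta> ! p}"

text \<open>The set \<open>above (\<eta> ! i) \<eta>\<close> contains \<open>i\<close>, which
  excludes distance 0 automatically, and step counts of a full turn or more exceed every clockwise
  distance.\<close>

lemma jump_dist_eq:
  assumes "i < length \<eta>" "0 \<in> set \<eta>" "0 < \<eta> ! i"
  shows "jump_dist \<eta> i (\<eta> ! i) = cdist (length \<eta>) i (next_free (length \<eta>) (above (\<eta> ! i) \<eta>) i)"
proof -
  let ?n = "length \<eta>" and ?S = "above (\<eta> ! i) \<eta>"
  let ?w = "next_free ?n ?S i"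
  have ex: "\<exists>w<?n. w \<notin> ?S"
    using assms by (auto simp: in_set_conv_nth above_def)
  note nf = next_free[OF ex, where i = i]
  have "?w \<noteq> i"
    using nf(2) assms by (auto simp: above_def)
  then have pos: "0 < cdist ?n i ?w"
    using cdist_inj[of ?w ?n i i] nf(1) assms(1) by fastforce
  show ?thesis
    unfolding jump_dist_def
  proof (rule Least_equality)
    show "0 < cdist ?n i ?w \<and> \<eta> ! ((i + cdist ?n i ?w) mod ?n) < \<eta> ! i"
      using pos nf assms by (auto simp: add_cdist_mod above_def)
  next
    fix y assume y: "0 < y \<and> \<eta> ! ((i + y) mod ?n) < \<eta> ! i"
    show "cdist ?n i ?w \<le> y"
    proof (cases "y < ?n")
      case True
      have "(i + y) mod ?n < ?n"
        using assms by (intro mod_less_divisor) auto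
      show ?thesis
      proof (rule ccontr)
        assume "\<not> cdist ?n i ?w \<le> y"
        then have "(i + y) mod ?n \<in> ?S"
          using nf(3)[of "(i + y) mod ?n"] cdist_add_mod[of i ?n y] assms True \<open>(i + y) mod ?n < ?n\<close> by auto
        then show False
          using y by (auto simp: above_def)
      qed
    next
      case False
      then show ?thesis
        using cdist_less[of i ?n ?w] nf assms by linarith
    qed
  qed
qed

text \<open>Induction along the cascade, well founded because the moving species strictly decreases.
  It replaces \<open>jump_dist\<close> and the termination test by what later proofs use: the
  landing site \<open>w\<close> holds a lower species, and no site passed on the way does.\<close>

lemma cascade_induct [consumes 2, case_names vacant move]:
  assumes "i < length \<eta>" "0 \<in> set \<eta>"
    and vacant: "\<And>i. i < length \<eta> \<Longrightarrow> \<eta> ! i = 0 \<Longrightarrow> cascade \<eta> (\<eta> ! i) i = [] \<Longrightarrow> P i"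
    and move: "\<And>i w. i < length \<eta> \<Longrightarrow> w < length \<eta> \<Longrightarrow> \<eta> ! w < \<eta> ! i \<Longrightarrow>
      (\<And>k. k < length \<eta> \<Longrightarrow> cdist (length \<eta>) i k < cdist (length \<eta>) i w \<Longrightarrow> \<eta> ! i \<le> \<eta> ! k) \<Longrightarrow>
      cascade \<eta> (\<eta> ! i) i = (\<eta> ! i, i, cdist (length \<eta>) i w) # cascade \<eta> (\<eta> ! w) w \<Longrightarrow>
      P w \<Longrightarrow> P i"
  shows "P i"
  using assms(1)
proof (induction "\<eta> ! i" arbitrary: i rule: less_induct)
  case less
  show ?case
  proof (cases "\<eta> ! i = 0")
    case True
    then show ?thesis
      using vacant[of i] less.prems by (simp add: cascade.simps)
  next
    case False
    let ?n = "length \<eta>" and ?S = "above (\<eta> ! i) \<eta>"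
    define w where "w = next_free ?n ?S i"
    have ex: "\<exists>w<?n. w \<notin> ?S"
      using assms(2) False by (auto simp: in_set_conv_nth above_def)
    note nf = next_free[OF ex, where i = i, folded w_def]
    have lt: "\<eta> ! w < \<eta> ! i"
      using nf by (auto simp: above_def)
    have jd: "jump_dist \<eta> i (\<eta> ! i) = cdist ?n i w"
      using jump_dist_eq[of i \<eta>] assms(2) less.prems False by (simp add: w_def)
    have "cascade \<eta> (\<eta> ! i) i = (\<eta> ! i, i, cdist ?n i w) # cascade \<eta> (\<eta> ! w) w"
      using False lt nf(1) less.prems
      by (subst cascade.simps) (simp add: jd Let_def add_cdist_mod)
    moreover have "P w"
      using less.hyps lt nf(1) by blast
    moreover have "\<And>k. k < ?n \<Longrightarrow> cdist ?n i k < cdist ?n i w \<Longrightarrow> \<eta> ! i \<le> \<eta> ! k"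
      using nf(3) by (auto simp: above_def)
    ultimately show ?thesis
      using move[of i w] less.prems nf(1) lt by blast
  qed
qed

section \<open>Effect of a cascade on the content and on the projected sets\<close>

abbreviation move :: "nat \<Rightarrow> nat \<times> nat \<times> nat \<Rightarrow> nat list \<Rightarrow> nat list" where
  "move n \<equiv> \<lambda>(r, i, d) \<xi>. \<xi>[(i + d) mod n := r]"

text \<open>Here \<open>\<xi>\<close> is a partly updated \<open>\<eta>\<close>; agreement is
  required only below the moving species, and all remaining landing sites are of that kind. Each
  move trades the species it overwrites for its own and the last overwrites a 0, so the changes
  telescope.\<close>

lemma mset_fold_cascade:
  assumes "i < length \<eta>" "0 \<in> set \<eta>" "length \<xi> = length \<eta>"
    and "\<And>p. p < length \<eta> \<Longrightarrow> \<eta> ! p < \<eta> ! i \<Longrightarrow> \<xi> ! p = \<eta> ! p"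
  shows "add_mset 0 (mset (fold (move (length \<eta>)) (cascade \<eta> (\<eta> ! i) i) \<xi>)) =
    add_mset (\<eta> ! i) (mset \<xi>)"
  using assms
proof (induction arbitrary: \<xi> rule: cascade_induct)
  case (vacant i)
  then show ?case by simp
next
  case (move i w)
  let ?\<xi> = "\<xi>[w := \<eta> ! i]"
  have "add_mset 0 (mset (fold (move (length \<eta>)) (cascade \<eta> (\<eta> ! w) w) ?\<xi>)) =
      add_mset (\<eta> ! w) (mset ?\<xi>)"
    using move by (intro move.IH) (auto simp: nth_list_update)
  also have "mset ?\<xi> = add_mset (\<eta> ! i) (mset \<xi> - {#\<eta> ! w#})"
    using move by (simp add: mset_update)
  also have "add_mset (\<eta> ! w) \<dots> = add_mset (\<eta> ! i) (mset \<xi>)"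
    using move.prems(2)[of w] move.hyps move.prems(1) nth_mem_mset[of w \<xi>]
    by (simp add: add_mset_commute)
  finally show ?case
    using move.hyps by (simp add: add_cdist_mod)
qed

lemma above_update_eq:
  assumes "w < length \<xi>" "c \<le> r \<longleftrightarrow> c \<le> \<xi> ! w"
  shows "above c (\<xi>[w := r]) = above c \<xi>"
  using assms by (auto simp: above_def nth_list_update split: if_splits)

text \<open>Species decrease along the cascade. Moves onto sites of species at least
  \<open>c\<close> and moves of species below \<open>c\<close> leave the set alone, so at most one
  move matters: the one passing from species at least \<open>c\<close> to below
  \<open>c\<close>.\<close>

lemma above_fold_cascade:
  assumes "i < length \<eta>" "0 \<in> set \<eta>" "length \<xi> = length \<eta>" "0 < c"
    and "\<And>p. p < length \<eta> \<Longrightarrow> \<eta> ! p < \<eta> ! i \<Longrightarrow> \<xi> ! p = \<eta> ! p"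
  shows "above c (fold (move (length \<eta>)) (cascade \<eta> (\<eta> ! i) i) \<xi>) =
    (if c \<le> \<eta> ! i then insert (next_free (length \<eta>) (above c \<eta>) i) (above c \<xi>) else above c \<xi>)"
  using assms
proof (induction arbitrary: \<xi> rule: cascade_induct)
  case (vacant i)
  then show ?case by simp
next
  case (move i w)
  let ?\<xi> = "\<xi>[w := \<eta> ! i]" and ?n = "length \<eta>"
  have "above c (fold (move ?n) (cascade \<eta> (\<eta> ! i) i) \<xi>) =
      above c (fold (move ?n) (cascade \<eta> (\<eta> ! w) w) ?\<xi>)"
    using move.hyps by (simp add: add_cdist_mod)
  also have "\<dots> = (if c \<le> \<eta> ! w then insert (next_free ?n (above c \<eta>) w) (above c ?\<xi>) else above c ?\<xi>)"
    using move by (intro move.IH) (auto simp: nth_list_update)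
  also have "\<dots> = (if c \<le> \<eta> ! i then insert (next_free ?n (above c \<eta>) i) (above c \<xi>) else above c \<xi>)"
  proof -
    have \<xi>w: "\<xi> ! w = \<eta> ! w"
      using move by simp
    consider "\<eta> ! i < c" | "c \<le> \<eta> ! i" "\<eta> ! w < c" | "c \<le> \<eta> ! w"
      by linarith
    then show ?thesis
    proof cases
      case 1
      then have "above c ?\<xi> = above c \<xi>"
        using \<xi>w move.hyps(2,3) move.prems(1)
        by (intro above_update_eq) auto
      then show ?thesis
        using 1 move.hyps(3) by simp
    next
      \<comment> \<open>The move that changes the set: every site skipped holds a species at least
        \<open>c\<close>, so \<open>w\<close> is the first site outside it.\<close>
      case 2
      then have "above c ?\<xi> = insert w (above c \<xi>)"
        using \<xi>w move.hyps(2) move.prems(1) by (auto simp: above_def nth_list_update split: if_splits)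
      moreover have "next_free ?n (above c \<eta>) i = w"
        using move.hyps 2 by (intro next_free_eqI) (auto simp: above_def intro: order_trans)
      ultimately show ?thesis
        using 2 by simp
    next
      case 3
      then have "above c ?\<xi> = above c \<xi>"
        using \<xi>w move.hyps(2,3) move.prems(1)
        by (intro above_update_eq) auto
      \<comment> \<open>All sites before \<open>w\<close> and \<open>w\<close> itself lie in the
        set, so the search from \<open>i\<close> runs past \<open>w\<close>; beyond
        \<open>w\<close>, distances from \<open>i\<close> and from \<open>w\<close> order the sites
        alike up to the free site.\<close>
      moreover have "next_free ?n (above c \<eta>) i = next_free ?n (above c \<eta>) w"
      proof -
        have ex: "\<exists>p<?n. p \<notin> above c \<eta>"
          using move.prems(2) assms(2) by (auto simp: in_set_conv_nth above_def)
        define u where "u = next_free ?n (above c \<eta>) w"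
        note nf = next_free[OF ex, where i = w, folded u_def]
        have *: "c \<le> \<eta> ! k" if "k < ?n" "cdist ?n i k < cdist ?n i w" for k
          using that move.hyps 3 by (meson less_le_not_le order_trans)
        have "cdist ?n i w \<le> cdist ?n i u"
          using *[of u] nf by (fastforce simp: above_def)
        then have "cdist ?n w k < cdist ?n w u"
          if "k < ?n" "cdist ?n i k < cdist ?n i u" "\<not> cdist ?n i k < cdist ?n i w" for k
          using that cdist_split[OF move.hyps(1,2), of k] cdist_split[OF move.hyps(1,2) nf(1)] by auto
        then show ?thesis
          unfolding u_def[symmetric]
          using nf * move.hyps(1) by (intro next_free_eqI) (auto simp: above_def)
      qed
      ultimately show ?thesis
        using 3 move.hyps(3) by auto
    qed
  qed
  finally show ?case .
qed

lemma mset_ring_bell: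
  assumes "j < length \<eta>" "0 \<in> set \<eta>"
  shows "mset (ring_bell \<eta> j) = mset \<eta>"
proof (cases "\<eta> ! j = 0")
  case False
  have upd: "\<eta>[j := 0] ! p = \<eta> ! p" if "\<eta> ! p < \<eta> ! j" for p
    using that by (metis less_irrefl nth_list_update_neq)
  have "add_mset 0 (mset (ring_bell \<eta> j)) = add_mset (\<eta> ! j) (mset (\<eta>[j := 0]))"
    using mset_fold_cascade[OF assms, of "\<eta>[j := 0]"] upd False
    by (simp add: ring_bell_def)
  also have "\<dots> = add_mset 0 (mset \<eta>)"
    using assms(1) by (simp add: mset_update add_mset_commute)
  finally show ?thesis by simp
qed (simp add: ring_bell_def)

text \<open>The lumping property: emptying \<open>j\<close> removes it from the set because
  \<open>0 < c\<close>, and the cascade then adds one site. Hence the projected set evolves by its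
  own rule.\<close>

lemma above_ring_bell:
  assumes "j < length \<eta>" "0 \<in> set \<eta>" "0 < c"
  shows "above c (ring_bell \<eta> j) = push (length \<eta>) (above c \<eta>) j"
proof (cases "\<eta> ! j = 0")
  case True
  then show ?thesis
    using assms by (simp add: ring_bell_def push_def above_def)
next
  case False
  have upd: "\<eta>[j := 0] ! p = \<eta> ! p" if "\<eta> ! p < \<eta> ! j" for p
    using that by (metis less_irrefl nth_list_update_neq)
  have "above c (\<eta>[j := 0]) = above c \<eta> - {j}"
    using assms by (auto simp: above_def nth_list_update split: if_splits)
  moreover have "j \<in> above c \<eta> \<longleftrightarrow> c \<le> \<eta> ! j"
    using assms by (simp add: above_def)
  ultimately show ?thesis
    using above_fold_cascade[OF assms(1,2) _ assms(3), of "\<eta>[j := 0]"] upd False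
    by (simp add: ring_bell_def push_def)
qed

section \<open>Edge crossings caused by one bell\<close>

definition crossings_above :: "nat list \<Rightarrow> nat \<Rightarrow> nat \<Rightarrow> nat \<Rightarrow> nat" where
  "crossings_above \<eta> j c k =
     length (filter (\<lambda>(r', i, d). c \<le> r' \<and> k \<in> (\<lambda>t. (i + t) mod length \<eta>) ` {..<d})
               (cascade \<eta> (\<eta> ! j) j))"

text \<open>A species at least \<open>c\<close> is either \<open>c\<close> or at least
  \<open>Suc c\<close>. The reals avoid truncated subtraction.\<close>

lemma crossings_eq_diff:
  "real (crossings \<eta> j c k) =
    real (crossings_above \<eta> j c k) - real (crossings_above \<eta> j (Suc c) k)"
proof -
  have "length (filter (\<lambda>(r', i, d). c \<le> r' \<and> k \<in> A i d) L) =
      length (filter (\<lambda>(r', i, d). r' = c \<and> k \<in> A i d) L) +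
      length (filter (\<lambda>(r', i, d). Suc c \<le> r' \<and> k \<in> A i d) L)"
    for L :: "(nat \<times> nat \<times> nat) list" and A :: "nat \<Rightarrow> nat \<Rightarrow> nat set"
    by (induction L) auto
  from this[of "\<lambda>i d. (\<lambda>t. (i + t) mod length \<eta>) ` {..<d}"] show ?thesis
    unfolding crossings_def crossings_above_def by simp
qed

text \<open>The moves of species at least \<open>c\<close> are consecutive arcs that together run
  from \<open>j\<close> to the first site outside \<open>above c \<eta>\<close>. This is less than a
  full turn, so no edge is crossed twice.\<close>

lemma crossings_above_eq:
  assumes "j < length \<eta>" "0 \<in> set \<eta>" "0 < c" "k < length \<eta>"
  shows "crossings_above \<eta> j c k = (if crosses (length \<eta>) (above c \<eta>) j k then 1 else 0)"
  using assms
proof (induction rule: cascade_induct)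
  case (vacant i)
  then show ?case
    by (force simp: crossings_above_def crosses_def above_def)
next
  case (move i w)
  let ?n = "length \<eta>"
  have arc: "k \<in> (\<lambda>t. (i + t) mod ?n) ` {..<cdist ?n i w} \<longleftrightarrow> cdist ?n i k < cdist ?n i w"
    using move.prems move.hyps cdist_less[of i ?n w] by (intro arc_iff) auto
  have rec: "crossings_above \<eta> i c k =
      (if c \<le> \<eta> ! i \<and> cdist ?n i k < cdist ?n i w then 1 else 0) + crossings_above \<eta> w c k"
    unfolding crossings_above_def move.hyps(5) by (simp add: arc)
  show ?case
  proof (cases "c \<le> \<eta> ! i")
    case False
    then have "i \<notin> above c \<eta>" "w \<notin> above c \<eta>"
      using move.hyps by (auto simp: above_def)
    then have "\<not> crosses ?n (above c \<eta>) i k" "\<not> crosses ?n (above c \<eta>) w k"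
      using move.hyps by (auto simp: crosses_def)
    then show ?thesis
      using rec False move.IH move.prems by simp
  next
    case True
    have *: "p \<in> above c \<eta>" if "p < ?n" "cdist ?n i p < cdist ?n i w" for p
      using move.hyps(4)[OF that] True that by (auto simp: above_def)
    show ?thesis
    proof (cases "cdist ?n i k < cdist ?n i w")
      case less: True
      then have "crosses ?n (above c \<eta>) i k"
        using * by (auto simp: crosses_def)
      \<comment> \<open>A second crossing would need all sites from \<open>w\<close> round to
        \<open>k\<close> in the set. With those between \<open>i\<close> and \<open>w\<close> this
        covers the whole ring and leaves no place for the vacancy \<open>p\<close>.\<close>
      moreover have "\<not> crosses ?n (above c \<eta>) w k"
      proof
        assume cr: "crosses ?n (above c \<eta>) w k"
        obtain p where p: "p < ?n" "\<eta> ! p = 0"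
          using assms(2) by (auto simp: in_set_conv_nth)
        then have "p \<notin> above c \<eta>"
          using assms(3) by (auto simp: above_def)
        then have "\<not> cdist ?n i p < cdist ?n i w" "\<not> cdist ?n w p \<le> cdist ?n w k"
          using *[of p] cr p by (auto simp: crosses_def)
        then show False
          using less cdist_split[OF move.hyps(1,2) p(1)] cdist_split[OF move.hyps(1,2) move.prems(2)]
            cdist_less[OF move.hyps(1) p(1)] by auto
      qed
      ultimately show ?thesis
        using rec True less move.IH move.prems by simp
    next
      case False
      \<comment> \<open>The sites before \<open>w\<close> are in the set anyway, and beyond
        \<open>w\<close> the two arcs ending in \<open>k\<close> coincide.\<close>
      have "crosses ?n (above c \<eta>) i k \<longleftrightarrow> crosses ?n (above c \<eta>) w k"
      proof -
        have "cdist ?n w p \<le> cdist ?n w k \<longleftrightarrow> cdist ?n i p \<le> cdist ?n i k"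
          if "p < ?n" "\<not> cdist ?n i p < cdist ?n i w" for p
          using that False cdist_split[OF move.hyps(1,2) that(1)]
            cdist_split[OF move.hyps(1,2) move.prems(2)] by auto
        then show ?thesis
          unfolding crosses_def using * by blast
      qed
      then show ?thesis
        using rec False move.IH move.prems by simp
    qed
  qed
qed

subsection \<open>The single-species process\<close>

definition subsets_of_card :: "nat \<Rightarrow> nat \<Rightarrow> nat set set" where
  "subsets_of_card n k = {S. S \<subseteq> {..<n} \<and> card S = k}"

lemma finite_subsets_of_card [simp]: "finite (subsets_of_card n k)"
  unfolding subsets_of_card_def by (rule finite_subset[of _ "Pow {..<n}"]) auto

lemma finite_member_subsets_of_card: "S \<in> subsets_of_card n k \<Longrightarrow> finite S"
  unfolding subsets_of_card_def using finite_subset by auto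

lemma exists_free: "S \<in> subsets_of_card n k \<Longrightarrow> k < n \<Longrightarrow> \<exists>w<n. w \<notin> S"
proof (rule ccontr)
  assume S: "S \<in> subsets_of_card n k" "k < n" and "\<not> (\<exists>w<n. w \<notin> S)"
  then have "S = {..<n}"
    by (auto simp: subsets_of_card_def)
  with S show False
    by (simp add: subsets_of_card_def)
qed

lemma exchange_in_subsets_of_card:
  "S \<in> subsets_of_card n k \<Longrightarrow> v \<in> S \<Longrightarrow> j < n \<Longrightarrow> j \<notin> S \<Longrightarrow> insert j (S - {v}) \<in> subsets_of_card n k"
  using finite_member_subsets_of_card[of S n k]
  by (auto simp: subsets_of_card_def card_insert_if card_Diff_singleton)
     (metis Suc_pred card_gt_0_iff empty_iff)

lemma esym_eq: "esym n x k = (\<Sum>S\<in>subsets_of_card n k. \<Prod>i\<in>S. x i)"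
  by (simp add: esym_def subsets_of_card_def)

lemma esym_pos:
  assumes "\<And>i. i < n \<Longrightarrow> x i > 0" "k \<le> n"
  shows "esym n x k > 0"
  unfolding esym_eq
proof (rule sum_pos)
  have "{..<k} \<in> subsets_of_card n k"
    using assms(2) by (auto simp: subsets_of_card_def)
  then show "subsets_of_card n k \<noteq> {}" by blast
next
  fix S assume "S \<in> subsets_of_card n k"
  then show "0 < (\<Prod>i\<in>S. x i)"
    using assms(1) by (intro prod_pos) (auto simp: subsets_of_card_def)
qed simp

text \<open>
  Bells that change nothing are counted on both sides, so that the right-hand side does not depend
  on \<open>S\<close> except through \<open>F S\<close>.
\<close>

definition balanced :: "nat \<Rightarrow> nat \<Rightarrow> (nat \<Rightarrow> real) \<Rightarrow> (nat set \<Rightarrow> real) \<Rightarrow> bool" where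
  "balanced n k x F \<longleftrightarrow> (\<forall>S\<in>subsets_of_card n k.
     (\<Sum>S'\<in>subsets_of_card n k. \<Sum>j<n. F S' / x j * of_bool (push n S' j = S)) =
     F S * (\<Sum>j<n. 1 / x j))"

text \<open>
  Hence the moves leading into \<open>S\<close> are in bijection with the sites \<open>v \<in> S\<close>: the particle now at \<open>v\<close>
  came from the first vacancy \<open>j\<close> of \<open>S\<close> anticlockwise from \<open>v\<close>.
\<close>

lemma push_eq_iff:
  assumes "S \<in> subsets_of_card n k" "k < n" "j < n"
    and "S' \<in> subsets_of_card n k" "j \<in> S'"
  shows "push n S' j = S \<longleftrightarrow> j \<notin> S \<and> (\<exists>v\<in>S. S' = insert j (S - {v}) \<and>
    (\<forall>i<n. cdist n i v < cdist n j v \<longrightarrow> i \<in> S))"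
proof
  assume eq: "push n S' j = S"
  define v where "v = next_free n S' j"
  note nf = next_free[OF exists_free[OF assms(4,2)], where i = j, folded v_def]
  have S: "S = insert v (S' - {j})"
    using eq assms by (simp add: push_def v_def)
  have "v \<noteq> j"
    using nf assms by auto
  have "i \<in> S" if "i < n" "cdist n i v < cdist n j v" for i
  proof (cases "i = v")
    case False
    have "cdist n j i \<le> cdist n j v" "i \<noteq> j"
      using that nf(1) assms(3) cdist_between[of j n i v] by auto
    then have "cdist n j i < cdist n j v"
      using cdist_inj[of i n v j] that False nf(1) assms(3) by (auto simp: le_less)
    then show ?thesis
      using S nf(3) that by auto
  qed (simp add: S)
  moreover have "S' = insert j (S - {v})"
    using S nf(2) assms by auto
  moreover have "j \<notin> S" "v \<in> S"
    using S \<open>v \<noteq> j\<close> by auto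
  ultimately show "j \<notin> S \<and> (\<exists>v\<in>S. S' = insert j (S - {v}) \<and>
    (\<forall>i<n. cdist n i v < cdist n j v \<longrightarrow> i \<in> S))"
    by blast
next
  assume "j \<notin> S \<and> (\<exists>v\<in>S. S' = insert j (S - {v}) \<and>
    (\<forall>i<n. cdist n i v < cdist n j v \<longrightarrow> i \<in> S))"
  then obtain v where v: "j \<notin> S" "v \<in> S" "S' = insert j (S - {v})"
    "\<And>i. i < n \<Longrightarrow> cdist n i v < cdist n j v \<Longrightarrow> i \<in> S"
    by blast
  have "v < n"
    using v(2) assms(1) by (auto simp: subsets_of_card_def)
  have "next_free n S' j = v"
  proof (rule next_free_eqI)
    fix i assume i: "i < n" "cdist n j i < cdist n j v"
    show "i \<in> S'"
    proof (cases "i = j")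
      case False
      then have "cdist n i v < cdist n j v" "i \<noteq> v"
        using i \<open>v < n\<close> assms(3) cdist_between[of j n i v] by auto
      then show ?thesis
        using v i by auto
    qed (simp add: v)
  qed (use v \<open>v < n\<close> assms in auto)
  then show "push n S' j = S"
    using v assms by (auto simp: push_def)
qed

section \<open>Stationarity of the product weight\<close>

definition prev_free :: "nat \<Rightarrow> nat set \<Rightarrow> nat \<Rightarrow> nat" where
  "prev_free n S v = (ARG_MIN (\<lambda>i. cdist n i v) i. i < n \<and> i \<notin> S)"

lemma prev_free:
  assumes "\<exists>w<n. w \<notin> S"
  shows "prev_free n S v < n" "prev_free n S v \<notin> S"
    and "\<And>i. i < n \<Longrightarrow> cdist n i v < cdist n (prev_free n S v) v \<Longrightarrow> i \<in> S"
proof -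
  obtain w where "w < n \<and> w \<notin> S"
    using assms by blast
  from arg_min_nat_lemma[of "\<lambda>w. w < n \<and> w \<notin> S", OF this, of "\<lambda>i. cdist n i v"]
  show "prev_free n S v < n" "prev_free n S v \<notin> S"
    and "\<And>i. i < n \<Longrightarrow> cdist n i v < cdist n (prev_free n S v) v \<Longrightarrow> i \<in> S"
    unfolding prev_free_def by (auto simp: not_le[symmetric])
qed

lemma prev_free_eqI:
  assumes "v < n" "j < n" "j \<notin> S"
    and "\<And>i. i < n \<Longrightarrow> cdist n i v < cdist n j v \<Longrightarrow> i \<in> S"
  shows "prev_free n S v = j"
proof -
  have ex: "\<exists>w<n. w \<notin> S"
    using assms by blast
  note pf = prev_free[OF ex, where v = v]
  have "cdist n (prev_free n S v) v = cdist n j v"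
    using pf(1,2) pf(3)[OF assms(2)] assms(3) assms(4)[OF pf(1)] by linarith
  then show ?thesis
    using cdist_inj_left pf(1) assms(1,2) by blast
qed

text \<open>The predecessor belonging to \<open>v\<close> has \<open>v\<close> replaced by the
  launching site, so its weight is that of \<open>S\<close> times
  \<open>x (prev_free n S v) / x v\<close>. The bell rate cancels the numerator and leaves
  \<open>1 / x v\<close>; bells at vacancies of \<open>S\<close> supply the remaining terms of the
  total rate.\<close>

lemma balanced_prod:
  assumes "\<And>i. i < n \<Longrightarrow> x i > 0" "k < n"
  shows "balanced n k x (\<lambda>S. \<Prod>i\<in>S. x i)"
  unfolding balanced_def
proof
  fix S assume S: "S \<in> subsets_of_card n k"
  let ?C = "subsets_of_card n k" and ?q = "\<lambda>S. \<Prod>i\<in>S. x i"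
  \<comment> \<open>\<open>B\<close> collects the bells that move a particle into \<open>S\<close>,
    \<open>A\<close> those that ring at a vacancy and change nothing.\<close>
  define B where "B = {(S', j). S' \<in> ?C \<and> j < n \<and> push n S' j = S \<and> j \<in> S'}"
  define A where "A = {(S', j). S' \<in> ?C \<and> j < n \<and> push n S' j = S \<and> j \<notin> S'}"
  define h where "h v = (insert (prev_free n S v) (S - {v}), prev_free n S v)" for v
  have Sn: "S \<subseteq> {..<n}" and finS: "finite S"
    using S finite_member_subsets_of_card[OF S] by (auto simp: subsets_of_card_def)
  note pf = prev_free[OF exists_free[OF S assms(2)]]
  have sub: "A \<union> B \<subseteq> ?C \<times> {..<n}"
    by (auto simp: A_def B_def)
  have fin: "finite A" "finite B"
    using finite_subset[OF sub] by auto
  have "bij_betw h S B"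
    unfolding bij_betw_def
  proof
    \<comment> \<open>The site \<open>v\<close> is recovered as the only element of \<open>S\<close>
      missing from the predecessor.\<close>
    have diff: "S - fst (h v) = {v}" if "v \<in> S" for v
      using pf(2)[of v] that by (auto simp: h_def)
    show "inj_on h S"
      by (rule inj_onI) (metis diff singleton_inject)
    show "h ` S = B"
    proof (intro equalityI subsetI)
      fix b assume "b \<in> h ` S"
      then obtain v where v: "v \<in> S" "b = h v" by blast
      have "insert (prev_free n S v) (S - {v}) \<in> ?C"
        using exchange_in_subsets_of_card[OF S v(1)] pf by blast
      moreover from this have "push n (insert (prev_free n S v) (S - {v})) (prev_free n S v) = S"
        using pf v by (subst push_eq_iff[OF S assms(2)]) blast+
      ultimately show "b \<in> B"
        using pf by (auto simp: v h_def B_def)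
    next
      fix b assume "b \<in> B"
      then obtain S' j where b: "b = (S', j)" "S' \<in> ?C" "j < n" "push n S' j = S" "j \<in> S'"
        by (auto simp: B_def)
      then obtain v where v: "j \<notin> S" "v \<in> S" "S' = insert j (S - {v})"
        "\<And>i. i < n \<Longrightarrow> cdist n i v < cdist n j v \<Longrightarrow> i \<in> S"
        using push_eq_iff[OF S assms(2) b(3,2,5)] by blast
      have "prev_free n S v = j"
        using v b Sn by (intro prev_free_eqI) auto
      then show "b \<in> h ` S"
        using v b by (auto simp: h_def)
    qed
  qed
  then have "(\<Sum>(S', j)\<in>B. ?q S' / x j) = (\<Sum>v\<in>S. ?q (fst (h v)) / x (snd (h v)))"
    by (simp add: sum.reindex_bij_betw[symmetric] case_prod_unfold)
  also have "\<dots> = (\<Sum>v\<in>S. ?q S * (1 / x v))"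
  proof (intro sum.cong refl)
    fix v assume v: "v \<in> S"
    have "?q S = x v * ?q (S - {v})"
      using v finS by (simp add: prod.remove)
    moreover have "x v > 0" "x (prev_free n S v) > 0"
      using v Sn assms(1) pf(1) by auto
    ultimately show "?q (fst (h v)) / x (snd (h v)) = ?q S * (1 / x v)"
      using pf(2)[of v] finS by (simp add: h_def)
  qed
  finally have B: "(\<Sum>(S', j)\<in>B. ?q S' / x j) = ?q S * (\<Sum>v\<in>S. 1 / x v)"
    by (simp add: sum_distrib_left)
  have "A = Pair S ` ({..<n} - S)"
    using S by (auto simp: A_def push_def)
  then have A: "(\<Sum>(S', j)\<in>A. ?q S' / x j) = ?q S * (\<Sum>v\<in>{..<n} - S. 1 / x v)"
    by (simp add: sum.reindex inj_on_def sum_distrib_left)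
  have "(\<Sum>S'\<in>?C. \<Sum>j<n. ?q S' / x j * of_bool (push n S' j = S)) =
      (\<Sum>(S', j)\<in>?C \<times> {..<n}. ?q S' / x j * of_bool (push n S' j = S))"
    by (simp add: sum.cartesian_product)
  also have "\<dots> = (\<Sum>(S', j)\<in>A \<union> B. ?q S' / x j * of_bool (push n S' j = S))"
    using sub by (intro sum.mono_neutral_right) (auto simp: A_def B_def)
  also have "\<dots> = (\<Sum>(S', j)\<in>A \<union> B. ?q S' / x j)"
    by (intro sum.cong) (auto simp: A_def B_def)
  also have "\<dots> = (\<Sum>(S', j)\<in>A. ?q S' / x j) + (\<Sum>(S', j)\<in>B. ?q S' / x j)"
    using fin by (intro sum.union_disjoint) (auto simp: A_def B_def)
  also have "\<dots> = ?q S * (\<Sum>j<n. 1 / x j)"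
    using sum.subset_diff[OF Sn, of "\<lambda>v. 1 / x v"] by (simp add: A B distrib_left)
  finally show "(\<Sum>S'\<in>?C. \<Sum>j<n. ?q S' / x j * of_bool (push n S' j = S)) =
      ?q S * (\<Sum>j<n. 1 / x j)" .
qed

text \<open>At a zero of \<open>G\<close> the total inflow is a vanishing sum of nonnegative terms,
  so every term is 0. Zeros thus spread backwards along moves.\<close>

lemma balanced_zero_step:
  assumes "balanced n k x G" "\<And>i. i < n \<Longrightarrow> x i > 0"
    and "\<And>S. S \<in> subsets_of_card n k \<Longrightarrow> G S \<ge> 0"
    and "S \<in> subsets_of_card n k" "G S = 0"
    and "S' \<in> subsets_of_card n k" "j < n" "push n S' j = S"
  shows "G S' = 0"
proof -
  let ?C = "subsets_of_card n k"
  have nn: "0 \<le> G T / x i * of_bool (push n T i = S)" if "T \<in> ?C" "i < n" for T i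
    using assms(2)[OF that(2)] assms(3)[OF that(1)] by simp
  have "(\<Sum>T\<in>?C. \<Sum>i<n. G T / x i * of_bool (push n T i = S)) = 0"
    using assms(1,4,5) by (simp add: balanced_def)
  then have "(\<Sum>i<n. G S' / x i * of_bool (push n S' i = S)) = 0"
    using nn assms(6) by (subst (asm) sum_nonneg_eq_0_iff) (auto intro!: sum_nonneg)
  then have "G S' / x j * of_bool (push n S' j = S) = 0"
    using nn assms(6,7) by (subst (asm) sum_nonneg_eq_0_iff) auto
  then show ?thesis
    using assms(2)[OF assms(7)] assms(8) by simp
qed

text \<open>
  Irreducibility: one particle can be brought to any vacancy by successive moves, the others being
  left where they are.
\<close>

lemma balanced_zero_exchange:
  assumes "balanced n k x G" "\<And>i. i < n \<Longrightarrow> x i > 0" "k < n"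
    and "\<And>S. S \<in> subsets_of_card n k \<Longrightarrow> G S \<ge> 0"
    and "S \<in> subsets_of_card n k" "G S = 0" "v \<in> S" "j < n" "j \<notin> S"
  shows "G (insert j (S - {v})) = 0"
  using assms(5-9)
proof (induction "cdist n j v" arbitrary: S v j rule: less_induct)
  case less
  let ?C = "subsets_of_card n k"
  have "v < n"
    using less.prems by (auto simp: subsets_of_card_def)
  have mem: "insert j (S - {v}) \<in> ?C"
    using less.prems by (intro exchange_in_subsets_of_card)
  show ?case
  proof (cases "\<forall>i<n. cdist n i v < cdist n j v \<longrightarrow> i \<in> S")
    case True
    then have "push n (insert j (S - {v})) j = S"
      using less.prems push_eq_iff[OF less.prems(1) assms(3) less.prems(4) mem] by blast
    then show ?thesis
      using balanced_zero_step[OF assms(1,2,4)] less.prems mem by blast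
  next
    case False
    \<comment> \<open>A vacancy \<open>i\<close> between \<open>j\<close> and \<open>v\<close>
      splits the exchange in two, \<open>v\<close> for \<open>i\<close> and then \<open>i\<close>
      for \<open>j\<close>, each over a shorter distance.\<close>
    then obtain i where i: "i < n" "cdist n i v < cdist n j v" "i \<notin> S"
      by blast
    then have zero: "G (insert i (S - {v})) = 0"
      using less by blast
    have "i \<noteq> j" "i \<noteq> v" "j \<noteq> v"
      using i less.prems by auto
    have "cdist n j i < cdist n j v"
      using i cdist_between[of j n i v] cdist_inj[of i n v j] \<open>i \<noteq> v\<close> \<open>v < n\<close> less.prems(4)
      by (auto simp: le_less)
    moreover have "insert i (S - {v}) \<in> ?C"
      using less.prems i by (intro exchange_in_subsets_of_card)
    ultimately have "G (insert j (insert i (S - {v}) - {i})) = 0"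
      using less.hyps[of j i "insert i (S - {v})"] zero less.prems \<open>i \<noteq> j\<close> by blast
    moreover have "insert i (S - {v}) - {i} = S - {v}"
      using i by blast
    ultimately show ?thesis by simp
  qed
qed

text \<open>Any two sets of equal size are linked by exchanges, each of which brings in one site of
  \<open>T\<close> missing from \<open>S\<close>.\<close>

lemma balanced_zero:
  assumes "balanced n k x G" "\<And>i. i < n \<Longrightarrow> x i > 0" "k < n"
    and "\<And>S. S \<in> subsets_of_card n k \<Longrightarrow> G S \<ge> 0"
    and "S \<in> subsets_of_card n k" "G S = 0" and "T \<in> subsets_of_card n k"
  shows "G T = 0"
  using assms(5,6)
proof (induction "card (T - S)" arbitrary: S rule: less_induct)
  case less
  have fin: "finite S" "finite T" "card S = card T"
    using less.prems assms(7) finite_member_subsets_of_card[OF less.prems(1)]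
      finite_member_subsets_of_card[OF assms(7)] by (auto simp: subsets_of_card_def)
  show ?case
  proof (cases "T \<subseteq> S")
    case True
    then show ?thesis
      using fin less.prems card_subset_eq by metis
  next
    case False
    then obtain j where j: "j \<in> T" "j \<notin> S" by blast
    have "\<not> S \<subseteq> T"
      using False fin card_subset_eq by metis
    then obtain v where v: "v \<in> S" "v \<notin> T" by blast
    have "j < n"
      using j assms(7) by (auto simp: subsets_of_card_def)
    have "T - insert j (S - {v}) \<subset> T - S"
      using j v by auto
    then have "card (T - insert j (S - {v})) < card (T - S)"
      using fin by (intro psubset_card_mono) auto
    then show ?thesis
      using less.hyps balanced_zero_exchange[OF assms(1-4) less.prems v(1) \<open>j < n\<close> j(2)]
        exchange_in_subsets_of_card[OF less.prems(1) v(1) \<open>j < n\<close> j(2)] by blast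
  qed
qed

text \<open>
  Subtract from \<open>F\<close> the largest multiple of the product weight that keeps it nonnegative; the
  difference vanishes somewhere, hence everywhere.
\<close>

lemma balanced_unique:
  assumes "balanced n k x F" "\<And>i. i < n \<Longrightarrow> x i > 0" "k < n"
    and "(\<Sum>S\<in>subsets_of_card n k. F S) = 1"
    and "S \<in> subsets_of_card n k"
  shows "F S = (\<Prod>i\<in>S. x i) / esym n x k"
proof -
  let ?C = "subsets_of_card n k" and ?q = "\<lambda>S. \<Prod>i\<in>S. x i"
  have q: "?q S > 0" if "S \<in> ?C" for S
    using that assms(2) by (intro prod_pos) (auto simp: subsets_of_card_def)
  define c where "c = Min ((\<lambda>S. F S / ?q S) ` ?C)"
  define G where "G S = F S - c * ?q S" for S
  have ne: "(\<lambda>S. F S / ?q S) ` ?C \<noteq> {}"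
    using assms(5) by blast
  have "c \<in> (\<lambda>S. F S / ?q S) ` ?C"
    unfolding c_def using ne by (intro Min_in) auto
  then obtain S0 where S0: "S0 \<in> ?C" "c = F S0 / ?q S0" by blast
  have G0: "G S0 = 0"
    using S0 q[OF S0(1)] by (simp add: G_def)
  have nn: "G T \<ge> 0" if "T \<in> ?C" for T
  proof -
    have "c \<le> F T / ?q T"
      unfolding c_def using that by (intro Min_le) auto
    then show ?thesis
      using q[OF that] by (simp add: G_def field_simps)
  qed
  have bal: "balanced n k x G"
    unfolding balanced_def
  proof
    fix S assume S: "S \<in> ?C"
    have "(\<Sum>S'\<in>?C. \<Sum>j<n. G S' / x j * of_bool (push n S' j = S)) =
      (\<Sum>S'\<in>?C. \<Sum>j<n. F S' / x j * of_bool (push n S' j = S)) -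
      c * (\<Sum>S'\<in>?C. \<Sum>j<n. ?q S' / x j * of_bool (push n S' j = S))"
      by (simp add: G_def sum_subtractf[symmetric] sum_distrib_left diff_divide_distrib left_diff_distrib mult.assoc)
    also have "\<dots> = G S * (\<Sum>j<n. 1 / x j)"
      using assms(1) balanced_prod[OF assms(2,3)] S
      by (simp add: balanced_def G_def left_diff_distrib)
    finally show "(\<Sum>S'\<in>?C. \<Sum>j<n. G S' / x j * of_bool (push n S' j = S)) =
      G S * (\<Sum>j<n. 1 / x j)" .
  qed
  have F: "F T = c * ?q T" if "T \<in> ?C" for T
    using balanced_zero[OF bal assms(2,3) nn S0(1) G0 that] by (simp add: G_def)
  have "1 = c * esym n x k"
    using assms(4) F by (simp add: esym_eq sum_distrib_left)
  moreover have "esym n x k > 0"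
    using assms(2,3) by (intro esym_pos) auto
  ultimately have "c = 1 / esym n x k"
    by (simp add: field_simps)
  then show ?thesis
    using F[OF assms(5)] by simp
qed

text \<open>
  Removing the site \<open>j\<close> from \<open>S\<close> is a bijection onto the smaller sets \<open>T\<close>: the site \<open>j\<close> is the
  first one not in \<open>T\<close> anticlockwise from \<open>e\<close>.
\<close>

lemma sum_crosses:
  assumes "\<And>i. i < n \<Longrightarrow> x i > 0" "k < n" "e < n"
  shows "(\<Sum>S\<in>subsets_of_card n (Suc k). \<Sum>j<n. (\<Prod>i\<in>S. x i) / x j * of_bool (crosses n S j e)) =
    esym n x k"
proof -
  let ?C = "subsets_of_card n (Suc k)" and ?q = "\<lambda>S. \<Prod>i\<in>S. x i"
  define B where "B = {(S, j). S \<in> ?C \<and> j < n \<and> crosses n S j e}"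
  define h where "h T = (insert (prev_free n T e) T, prev_free n T e)" for T
  have fin: "finite S" if "S \<in> subsets_of_card n k" for S
    using that finite_member_subsets_of_card by blast
  have sub: "B \<subseteq> ?C \<times> {..<n}"
    by (auto simp: B_def)
  have pf: "prev_free n T e < n" "prev_free n T e \<notin> T"
    "\<And>i. i < n \<Longrightarrow> cdist n i e < cdist n (prev_free n T e) e \<Longrightarrow> i \<in> T"
    if "T \<in> subsets_of_card n k" for T
    using prev_free[OF exists_free[OF that assms(2)], where v = e] by auto
  have arc: "cdist n j i \<le> cdist n j e \<longleftrightarrow> i = j \<or> cdist n i e < cdist n j e" if "i < n" "j < n" for i j
    using that assms(3) by (intro cdist_between)
  have "bij_betw h (subsets_of_card n k) B"
    unfolding bij_betw_def
  proof
    show "inj_on h (subsets_of_card n k)"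
      using pf(2) by (auto simp: inj_on_def h_def) (metis insert_ident)+
    show "h ` subsets_of_card n k = B"
    proof (intro equalityI subsetI)
      fix b assume "b \<in> h ` subsets_of_card n k"
      then obtain T where T: "T \<in> subsets_of_card n k" "b = h T" by blast
      \<comment> \<open>If \<open>e\<close> is outside \<open>T\<close>, then
        \<open>prev_free n T e\<close> is \<open>e\<close> and the arc is a single site.\<close>
      have "crosses n (insert (prev_free n T e) T) (prev_free n T e) e"
        using pf[OF T(1)] arc by (auto simp: crosses_def)
      moreover have "insert (prev_free n T e) T \<in> ?C"
        using pf(1,2)[OF T(1)] T(1) fin[OF T(1)] by (auto simp: subsets_of_card_def)
      ultimately show "b \<in> B"
        using pf(1)[OF T(1)] by (auto simp: T(2) h_def B_def)
    next
      fix b assume "b \<in> B"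
      then obtain S j where b: "b = (S, j)" "S \<in> ?C" "j < n" "crosses n S j e"
        by (auto simp: B_def)
      have "j \<in> S"
        using b by (auto simp: crosses_def)
      then have "S - {j} \<in> subsets_of_card n k"
        using b(2) by (auto simp: subsets_of_card_def)
      moreover have "prev_free n (S - {j}) e = j"
        using b arc assms(3) by (intro prev_free_eqI) (auto simp: crosses_def)
      ultimately show "b \<in> h ` subsets_of_card n k"
        using b \<open>j \<in> S\<close> by (intro image_eqI[of _ _ "S - {j}"]) (auto simp: h_def)
    qed
  qed
  have "(\<Sum>S\<in>?C. \<Sum>j<n. ?q S / x j * of_bool (crosses n S j e)) =
      (\<Sum>(S, j)\<in>?C \<times> {..<n}. ?q S / x j * of_bool (crosses n S j e))"
    by (simp add: sum.cartesian_product)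
  also have "\<dots> = (\<Sum>(S, j)\<in>B. ?q S / x j * of_bool (crosses n S j e))"
    using sub by (intro sum.mono_neutral_right) (auto simp: B_def)
  also have "\<dots> = (\<Sum>(S, j)\<in>B. ?q S / x j)"
    by (intro sum.cong) (auto simp: B_def)
  also have "\<dots> = (\<Sum>T\<in>subsets_of_card n k. ?q (fst (h T)) / x (snd (h T)))"
    using \<open>bij_betw h (subsets_of_card n k) B\<close>
    by (simp add: sum.reindex_bij_betw[symmetric] case_prod_unfold)
  also have "\<dots> = esym n x k"
    unfolding esym_eq
  proof (intro sum.cong refl)
    fix T assume T: "T \<in> subsets_of_card n k"
    then show "?q (fst (h T)) / x (snd (h T)) = ?q T"
      using pf(1,2)[OF T] fin[OF T] assms(1)[of "prev_free n T e"] by (simp add: h_def)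
  qed
  finally show ?thesis .
qed

subsection \<open>Schur polynomials of two-column shapes\<close>

lemma subsets_of_card_0 [simp]: "subsets_of_card n 0 = {{}}"
  by (auto simp: subsets_of_card_def finite_subset[of _ "{..<n}"])

text \<open>Pascal's rule, by whether the largest site \<open>n\<close> is chosen; the source of the
  recursions in \<open>n\<close> below.\<close>

lemma sum_subsets_of_card_Suc:
  "(\<Sum>A\<in>subsets_of_card (Suc n) (Suc k). f A) =
    (\<Sum>A\<in>subsets_of_card n (Suc k). f A) + (\<Sum>A\<in>subsets_of_card n k. f (insert n A))"
proof -
  have "inj_on (insert n) (subsets_of_card n k)"
  proof (rule inj_onI)
    fix A B assume "A \<in> subsets_of_card n k" "B \<in> subsets_of_card n k" "insert n A = insert n B"
    moreover from this have "n \<notin> A" "n \<notin> B"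
      by (auto simp: subsets_of_card_def)
    ultimately show "A = B"
      by (metis insert_ident)
  qed
  moreover have "subsets_of_card (Suc n) (Suc k) =
      subsets_of_card n (Suc k) \<union> insert n ` subsets_of_card n k"
  proof (intro equalityI subsetI)
    fix A assume A: "A \<in> subsets_of_card (Suc n) (Suc k)"
    show "A \<in> subsets_of_card n (Suc k) \<union> insert n ` subsets_of_card n k"
    proof (cases "n \<in> A")
      case True
      then have "A - {n} \<in> subsets_of_card n k"
        using A by (auto simp: subsets_of_card_def less_Suc_eq)
      then show ?thesis
        using True by (metis UnI2 image_eqI insert_Diff)
    next
      case False
      then show ?thesis
        using A by (force simp: subsets_of_card_def less_Suc_eq)
    qed
  next
    fix A assume "A \<in> subsets_of_card n (Suc k) \<union> insert n ` subsets_of_card n k"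
    then show "A \<in> subsets_of_card (Suc n) (Suc k)"
      using finite_subset[of _ "{..<n}"]
      by (fastforce simp: subsets_of_card_def card_insert_if less_Suc_eq)
  qed
  moreover have "subsets_of_card n (Suc k) \<inter> insert n ` subsets_of_card n k = {}"
    by (auto simp: subsets_of_card_def)
  ultimately show ?thesis
    by (simp add: sum.union_disjoint sum.reindex)
qed

lemma prod_insert_subset_lessThan:
  "A \<in> subsets_of_card n k \<Longrightarrow> (\<Prod>i\<in>insert n A. x i) = x n * (\<Prod>i\<in>A. x i :: real)"
  using finite_member_subsets_of_card[of A n k] by (subst prod.insert) (auto simp: subsets_of_card_def)

lemma esym_0 [simp]: "esym n x 0 = 1"
  by (simp add: esym_eq)

lemma esym_Suc_Suc: "esym (Suc n) x (Suc k) = esym n x (Suc k) + x n * esym n x k"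
  by (simp add: esym_eq sum_subsets_of_card_Suc prod_insert_subset_lessThan sum_distrib_left)

text \<open>
  For the sets \<open>A\<close> and \<open>B\<close> of entries of two columns, the first at least as long as the second,
  this says that the rows of the tableau are weakly increasing.
\<close>

definition ballot :: "nat \<Rightarrow> nat set \<Rightarrow> nat set \<Rightarrow> bool" where
  "ballot n A B \<longleftrightarrow> (\<forall>v\<le>n. card (B \<inter> {..<v}) \<le> card (A \<inter> {..<v}))"

definition ballot_sum :: "nat \<Rightarrow> (nat \<Rightarrow> real) \<Rightarrow> nat \<Rightarrow> nat \<Rightarrow> real" where
  "ballot_sum n x a b = (\<Sum>A\<in>subsets_of_card n a. \<Sum>B\<in>subsets_of_card n b.
     of_bool (ballot n A B) * ((\<Prod>i\<in>A. x i) * (\<Prod>i\<in>B. x i)))"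

text \<open>The only new condition, at \<open>v = Suc n\<close>, compares the full cardinalities and
  holds by assumption.\<close>

lemma ballot_Suc:
  assumes "A \<subseteq> {..<Suc n}" "B \<subseteq> {..<Suc n}" "card B \<le> card A"
  shows "ballot (Suc n) A B \<longleftrightarrow> ballot n A B"
proof -
  have "A \<inter> {..<Suc n} = A" "B \<inter> {..<Suc n} = B"
    using assms by auto
  then show ?thesis
    using assms(3) by (auto simp: ballot_def le_Suc_eq)
qed

lemma ballot_insert:
  "ballot n (insert n A) B \<longleftrightarrow> ballot n A B" "ballot n A (insert n B) \<longleftrightarrow> ballot n A B"
  by (auto simp: ballot_def)

text \<open>The four terms record which of the two columns contain \<open>n\<close>. If
  \<open>a = b\<close>, the term with \<open>a\<close> and \<open>Suc b\<close> has a second column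
  longer than the first and vanishes.\<close>

lemma ballot_sum_Suc:
  assumes "b \<le> a"
  shows "ballot_sum (Suc n) x (Suc a) (Suc b) =
    ballot_sum n x (Suc a) (Suc b) + x n * ballot_sum n x a (Suc b) +
    x n * ballot_sum n x (Suc a) b + x n ^ 2 * ballot_sum n x a b"
proof -
  let ?C = "subsets_of_card n" and ?q = "\<lambda>S. \<Prod>i\<in>S. x i"
  have mem: "A \<subseteq> {..<Suc n} \<and> insert n A \<subseteq> {..<Suc n} \<and> card A = k \<and> card (insert n A) = Suc k"
    if "A \<in> ?C k" for A k
    using that finite_member_subsets_of_card[OF that]
    by (auto simp: subsets_of_card_def card_insert_if)
  have "ballot_sum (Suc n) x (Suc a) (Suc b) =
      (\<Sum>A\<in>?C (Suc a). \<Sum>B\<in>?C (Suc b). of_bool (ballot (Suc n) A B) * (?q A * ?q B)) +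
      (\<Sum>A\<in>?C (Suc a). \<Sum>B\<in>?C b. of_bool (ballot (Suc n) A (insert n B)) * (?q A * ?q (insert n B))) +
      ((\<Sum>A\<in>?C a. \<Sum>B\<in>?C (Suc b). of_bool (ballot (Suc n) (insert n A) B) * (?q (insert n A) * ?q B)) +
      (\<Sum>A\<in>?C a. \<Sum>B\<in>?C b. of_bool (ballot (Suc n) (insert n A) (insert n B)) * (?q (insert n A) * ?q (insert n B))))"
    unfolding ballot_sum_def by (simp add: sum_subsets_of_card_Suc sum.distrib)
  also have "(\<Sum>A\<in>?C (Suc a). \<Sum>B\<in>?C (Suc b). of_bool (ballot (Suc n) A B) * (?q A * ?q B)) =
      ballot_sum n x (Suc a) (Suc b)"
    unfolding ballot_sum_def using assms mem by (intro sum.cong refl) (auto simp: ballot_Suc)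
  also have "(\<Sum>A\<in>?C (Suc a). \<Sum>B\<in>?C b. of_bool (ballot (Suc n) A (insert n B)) * (?q A * ?q (insert n B))) =
      x n * ballot_sum n x (Suc a) b"
    unfolding ballot_sum_def sum_distrib_left using assms mem
    by (intro sum.cong refl) (auto simp: ballot_Suc ballot_insert prod_insert_subset_lessThan)
  also have "(\<Sum>A\<in>?C a. \<Sum>B\<in>?C (Suc b). of_bool (ballot (Suc n) (insert n A) B) * (?q (insert n A) * ?q B)) =
      x n * ballot_sum n x a (Suc b)"
    unfolding ballot_sum_def sum_distrib_left using assms mem
    by (intro sum.cong refl) (auto simp: ballot_Suc ballot_insert prod_insert_subset_lessThan)
  also have "(\<Sum>A\<in>?C a. \<Sum>B\<in>?C b. of_bool (ballot (Suc n) (insert n A) (insert n B)) * (?q (insert n A) * ?q (insert n B))) =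
      x n ^ 2 * ballot_sum n x a b"
    unfolding ballot_sum_def sum_distrib_left using assms mem
    by (intro sum.cong refl)
      (auto simp: ballot_Suc ballot_insert prod_insert_subset_lessThan power2_eq_square)
  finally show ?thesis by simp
qed

lemma ballot_sum_0: "ballot_sum n x a 0 = esym n x a"
  by (simp add: ballot_sum_def esym_eq ballot_def)

lemma ballot_sum_eq_0:
  assumes "a < b"
  shows "ballot_sum n x a b = 0"
proof -
  have "\<not> ballot n A B" if "A \<in> subsets_of_card n a" "B \<in> subsets_of_card n b" for A B
  proof -
    have "A \<inter> {..<n} = A" "B \<inter> {..<n} = B"
      using that by (auto simp: subsets_of_card_def)
    then show ?thesis
      using that assms by (auto simp: ballot_def subsets_of_card_def intro!: exI[of _ n])
  qed
  then show ?thesis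
    by (simp add: ballot_sum_def)
qed

text \<open>
  Both sides satisfy the same recursion in \<open>n\<close>; allowing \<open>a = b\<close>, where both vanish, supplies the
  boundary value.
\<close>

lemma ballot_sum_eq:
  assumes "b \<le> a"
  shows "ballot_sum n x a (Suc b) = esym n x a * esym n x (Suc b) - esym n x (Suc a) * esym n x b"
  using assms
proof (induction n arbitrary: a b)
  case 0
  have "subsets_of_card 0 (Suc k) = {}" for k
    by (auto simp: subsets_of_card_def)
  then show ?case
    by (simp add: ballot_sum_def esym_eq)
next
  case (Suc n)
  show ?case
  proof (cases "a = b")
    case True
    then show ?thesis
      by (simp add: ballot_sum_eq_0)
  next
    case False
    then obtain a' where a: "a = Suc a'" "b \<le> a'"
      using Suc.prems by (cases a) auto
    show ?thesis
    \<comment> \<open>The recursion also yields sums with second index \<open>b\<close>. The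
      induction hypothesis covers them only for positive \<open>b\<close>; for 0 they are
      \<open>ballot_sum_0\<close>.\<close>
    proof (cases b)
      case 0
      then show ?thesis
        using a by (simp add: ballot_sum_Suc Suc.IH ballot_sum_0 esym_Suc_Suc algebra_simps power2_eq_square)
    next
      case (Suc b')
      then show ?thesis
        using a by (simp add: ballot_sum_Suc Suc.IH esym_Suc_Suc algebra_simps power2_eq_square)
    qed
  qed
qed

section \<open>Columns of a tableau as sorted sets\<close>

definition kth :: "nat set \<Rightarrow> nat \<Rightarrow> nat" where
  "kth A r = sorted_list_of_set A ! r"

lemma kth_less_kth:
  assumes "finite A" "r < r'" "r' < card A"
  shows "kth A r < kth A r'"
proof -
  have "sorted_wrt (<) (sorted_list_of_set A)"
    by simp
  then show ?thesis
    using assms by (simp add: kth_def sorted_wrt_nth_less)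
qed

lemma kth_le_kth: "finite A \<Longrightarrow> r \<le> r' \<Longrightarrow> r' < card A \<Longrightarrow> kth A r \<le> kth A r'"
  using kth_less_kth[of A r r'] by (auto simp: le_less)

lemma kth_inj_on: "finite A \<Longrightarrow> inj_on (kth A) {..<card A}"
  by (rule linorder_inj_onI') (use kth_less_kth in \<open>fastforce\<close>)

lemma kth_image: "finite A \<Longrightarrow> kth A ` {..<card A} = A"
proof -
  assume "finite A"
  then have "A = set (sorted_list_of_set A)" by simp
  also have "\<dots> = kth A ` {..<card A}"
    by (auto simp: set_conv_nth kth_def simp del: set_sorted_list_of_set)
  finally show ?thesis by simp
qed

text \<open>The increasing enumeration of a finite set is unique, so a strictly increasing column is
  recovered from its set of entries.\<close>

lemma kth_image_strict_mono:
  assumes "\<And>r r'. r < r' \<Longrightarrow> r' < a \<Longrightarrow> f r < f r'" "r < a"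
  shows "kth (f ` {..<a}) r = f r"
proof -
  have inj: "inj_on f {..<a}"
    by (rule linorder_inj_onI') (use assms(1) in fastforce)
  have "sorted_list_of_set (f ` {..<a}) = map f [0..<a]"
  proof -
    have "sorted_wrt (<) (map f [0..<a])"
      using assms(1) by (auto simp: sorted_wrt_iff_nth_less)
    moreover have "set (map f [0..<a]) = f ` {..<a}"
      by auto
    ultimately show ?thesis
      using inj by (metis card_image card_lessThan finite_imageI finite_lessThan length_map length_upt
          minus_nat.diff_0 sorted_list_of_set_unique)
  qed
  then show ?thesis
    using assms(2) by (simp add: kth_def)
qed

text \<open>The bridge between rows and prefix counts: the elements of \<open>A\<close> below
  \<open>v\<close> fill an initial segment of its rows, counted from 0.\<close>

lemma kth_less_iff:
  assumes "finite A" "r < card A"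
  shows "kth A r < v \<longleftrightarrow> r < card (A \<inter> {..<v})"
proof
  assume "kth A r < v"
  then have "kth A r' < v" if "r' \<le> r" for r'
    using kth_le_kth[OF assms(1) that assms(2)] by simp
  moreover have "kth A r' \<in> A" if "r' \<le> r" for r'
    using kth_image[OF assms(1)] that assms(2) by auto
  ultimately have "kth A ` {..r} \<subseteq> A \<inter> {..<v}"
    by auto
  then have "card (kth A ` {..r}) \<le> card (A \<inter> {..<v})"
    using assms by (intro card_mono) auto
  moreover have "card (kth A ` {..r}) = Suc r"
    using inj_on_subset[OF kth_inj_on[OF assms(1)], of "{..r}"] assms(2)
    by (simp add: card_image subset_eq)
  ultimately show "r < card (A \<inter> {..<v})" by simp
next
  assume less: "r < card (A \<inter> {..<v})"
  show "kth A r < v"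
  proof (rule ccontr)
    assume ge: "\<not> kth A r < v"
    have "A \<inter> {..<v} \<subseteq> kth A ` {..<r}"
    proof
      fix i assume i: "i \<in> A \<inter> {..<v}"
      then obtain r' where r': "r' < card A" "i = kth A r'"
        using kth_image[OF assms(1)] by blast
      then have "r' < r"
        using kth_le_kth[OF assms(1), of r r'] ge i by fastforce
      then show "i \<in> kth A ` {..<r}"
        using r' by blast
    qed
    then have "card (A \<inter> {..<v}) \<le> card (kth A ` {..<r})"
      by (intro card_mono) auto
    also have "\<dots> \<le> r"
      using card_image_le[of "{..<r}" "kth A"] by simp
    finally show False
      using less by simp
  qed
qed

lemma ballot_iff_kth_le:
  assumes "A \<in> subsets_of_card n a" "B \<in> subsets_of_card n b" "b \<le> a"
  shows "ballot n A B \<longleftrightarrow> (\<forall>r<b. kth A r \<le> kth B r)"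
proof -
  have fin: "finite A" "finite B" and card: "card A = a" "card B = b" and sub: "B \<subseteq> {..<n}"
    using assms finite_member_subsets_of_card[OF assms(1)] finite_member_subsets_of_card[OF assms(2)]
    by (auto simp: subsets_of_card_def)
  show ?thesis
  proof
    assume bal: "ballot n A B"
    show "\<forall>r<b. kth A r \<le> kth B r"
    proof (intro allI impI)
      fix r assume r: "r < b"
      have "kth B r \<in> B"
        using kth_image[OF fin(2)] r card by blast
      then have "Suc (kth B r) \<le> n"
        using sub by auto
      moreover have "r < card (B \<inter> {..<Suc (kth B r)})"
        using kth_less_iff[OF fin(2)] r card by blast
      ultimately have "r < card (A \<inter> {..<Suc (kth B r)})"
        using bal by (auto simp: ballot_def intro: less_le_trans)
      then have "kth A r < Suc (kth B r)"
        using kth_less_iff[OF fin(1)] r card assms(3) by auto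
      then show "kth A r \<le> kth B r" by simp
    qed
  next
    assume le: "\<forall>r<b. kth A r \<le> kth B r"
    show "ballot n A B"
      unfolding ballot_def
    proof (intro allI impI)
      fix v
      show "card (B \<inter> {..<v}) \<le> card (A \<inter> {..<v})"
      proof (rule ccontr)
        \<comment> \<open>If the condition fails at \<open>v\<close>, row \<open>r\<close> of
          \<open>B\<close> is below \<open>v\<close>, hence by \<open>le\<close> so is row
          \<open>r\<close> of \<open>A\<close>; but the elements of \<open>A\<close> below
          \<open>v\<close> fill only the \<open>r\<close> rows before it.\<close>
        define r where "r = card (A \<inter> {..<v})"
        assume "\<not> card (B \<inter> {..<v}) \<le> card (A \<inter> {..<v})"
        then have r: "r < card (B \<inter> {..<v})"
          by (simp add: r_def)
        also have "\<dots> \<le> b"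
          using card_mono[OF fin(2), of "B \<inter> {..<v}"] card by simp
        finally have "r < b" .
        then have "kth A r < v"
          using kth_less_iff[OF fin(2), of r v] le r card by fastforce
        then have "r < card (A \<inter> {..<v})"
          using kth_less_iff[OF fin(1)] \<open>r < b\<close> card assms(3) by auto
        then show False
          by (simp add: r_def)
      qed
    qed
  qed
qed

lemma cells_two_columns:
  "cells (replicate b 2 @ replicate d 1) = (\<lambda>r. (r, 0)) ` {..<b + d} \<union> (\<lambda>r. (r, 1)) ` {..<b}"
  by (auto simp: cells_def nth_append less_2_cases_iff split: if_splits)

text \<open>Strictly increasing columns are determined by their entry sets, and the row condition
  then becomes \<open>ballot\<close> by \<open>ballot_iff_kth_le\<close>.\<close>

lemma schur_two_columns:
  "schur n x (replicate b 2 @ replicate d 1) = ballot_sum n x (b + d) b"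
proof -
  define \<mu> where "\<mu> = replicate b (2::nat) @ replicate d 1"
  define P where "P = {(A, B) \<in> subsets_of_card n (b + d) \<times> subsets_of_card n b. ballot n A B}"
  define columns where "columns T = ((\<lambda>r. T (r, 0)) ` {..<b + d}, (\<lambda>r. T (r, 1)) ` {..<b})"
    for T :: "nat \<times> nat \<Rightarrow> nat"
  \<comment> \<open>Restriction to the cells makes the function extensional, as membership in
    \<open>ssyt\<close> demands.\<close>
  define tableau where "tableau = (\<lambda>(A, B). restrict (\<lambda>(r, c). kth (if c = 0 then A else B) r) (cells \<mu>))"
  have cells: "cells \<mu> = (\<lambda>r. (r, 0)) ` {..<b + d} \<union> (\<lambda>r. (r, 1)) ` {..<b}"
    unfolding \<mu>_def by (rule cells_two_columns)
  have mem: "(r, c) \<in> cells \<mu> \<longleftrightarrow> c = 0 \<and> r < b + d \<or> c = 1 \<and> r < b" for r c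
    unfolding cells by auto
  have T: "(\<forall>r<b + d. T (r, 0) < n) \<and> (\<forall>r<b. T (r, 1) < n) \<and> (\<forall>r<b. T (r, 0) \<le> T (r, 1)) \<and>
      (\<forall>r r'. r < r' \<longrightarrow> r' < b + d \<longrightarrow> T (r, 0) < T (r', 0)) \<and>
      (\<forall>r r'. r < r' \<longrightarrow> r' < b \<longrightarrow> T (r, 1) < T (r', 1))"
    if "T \<in> ssyt n \<mu>" for T
    using that by (force simp: ssyt_def mem PiE_iff)
  have inj: "inj_on (\<lambda>r. T (r, 0)) {..<b + d}" "inj_on (\<lambda>r. T (r, 1)) {..<b}"
    if "T \<in> ssyt n \<mu>" for T
    by (rule linorder_inj_onI', use T[OF that] in fastforce)+
  have kth: "kth ((\<lambda>r. T (r, 0)) ` {..<b + d}) r = T (r, 0)" if "T \<in> ssyt n \<mu>" "r < b + d" for T r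
    using T[OF that(1)] that(2) by (intro kth_image_strict_mono) auto
  have kth': "kth ((\<lambda>r. T (r, 1)) ` {..<b}) r = T (r, 1)" if "T \<in> ssyt n \<mu>" "r < b" for T r
    using T[OF that(1)] that(2) by (intro kth_image_strict_mono) auto
  have P: "finite A \<and> finite B \<and> card A = b + d \<and> card B = b \<and> A \<subseteq> {..<n} \<and> B \<subseteq> {..<n} \<and>
      kth A ` {..<b + d} = A \<and> kth B ` {..<b} = B \<and> (\<forall>r<b. kth A r \<le> kth B r)"
    if "(A, B) \<in> P" for A B
  proof -
    have AB: "A \<in> subsets_of_card n (b + d)" "B \<in> subsets_of_card n b" "ballot n A B"
      using that by (auto simp: P_def)
    show ?thesis
      using AB finite_member_subsets_of_card[OF AB(1)] finite_member_subsets_of_card[OF AB(2)]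
        kth_image[of A] kth_image[of B] ballot_iff_kth_le[OF AB(1,2)]
      by (auto simp: subsets_of_card_def)
  qed
  have "schur n x \<mu> = (\<Sum>p\<in>P. (\<Prod>i\<in>fst p. x i) * (\<Prod>i\<in>snd p. x i))"
    unfolding schur_def
  proof (rule sum.reindex_bij_witness[of _ tableau columns])
    fix T assume "T \<in> ssyt n \<mu>"
    note T = T[OF this] and inj = inj[OF this] and kth = kth[OF this] and kth' = kth'[OF this]
      and ext = \<open>T \<in> ssyt n \<mu>\<close>
    show "tableau (columns T) = T"
    proof
      fix p
      show "tableau (columns T) p = T p"
      proof (cases p)
        case (Pair r c)
        then show ?thesis
          using kth kth' ext mem
          by (auto simp: tableau_def columns_def ssyt_def PiE_iff extensional_def)
      qed
    qed
    have "fst (columns T) \<in> subsets_of_card n (b + d)" "snd (columns T) \<in> subsets_of_card n b"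
      using T inj by (auto simp: columns_def subsets_of_card_def card_image)
    moreover from this have "ballot n (fst (columns T)) (snd (columns T))"
      using T kth kth' by (subst ballot_iff_kth_le) (auto simp: columns_def)
    ultimately show "columns T \<in> P"
      by (auto simp: P_def case_prod_unfold mem_Times_iff)
    have "(\<Prod>c\<in>cells \<mu>. x (T c)) =
        (\<Prod>c\<in>(\<lambda>r. (r, 0)) ` {..<b + d}. x (T c)) * (\<Prod>c\<in>(\<lambda>r. (r, 1)) ` {..<b}. x (T c))"
      unfolding cells by (intro prod.union_disjoint) auto
    then show "(\<Prod>i\<in>fst (columns T). x i) * (\<Prod>i\<in>snd (columns T). x i) = (\<Prod>c\<in>cells \<mu>. x (T c))"
      using inj by (simp add: columns_def prod.reindex inj_on_def)
  next
    fix p assume "p \<in> P"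
    then obtain A B where p: "p = (A, B)" "(A, B) \<in> P"
      by (cases p) auto
    note P = P[OF p(2)]
    have "(\<lambda>r. tableau p (r, 0)) ` {..<b + d} = A" "(\<lambda>r. tableau p (r, 1)) ` {..<b} = B"
      using P by (simp_all add: tableau_def p mem cong: image_cong_simp)
    then show "columns (tableau p) = p"
      by (simp add: columns_def p)
    have lt: "kth A r < n" if "r < b + d" for r
      using P that by blast
    have lt': "kth B r < n" if "r < b" for r
      using P that by blast
    show "tableau p \<in> ssyt n \<mu>"
      using P lt lt' kth_less_kth[of A] kth_less_kth[of B]
      by (auto simp: ssyt_def tableau_def p mem PiE_iff split: if_splits)
  qed
  also have "\<dots> = ballot_sum n x (b + d) b"
  proof -
    have "ballot_sum n x (b + d) b = (\<Sum>p\<in>subsets_of_card n (b + d) \<times> subsets_of_card n b.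
        of_bool (ballot n (fst p) (snd p)) * ((\<Prod>i\<in>fst p. x i) * (\<Prod>i\<in>snd p. x i)))"
      unfolding ballot_sum_def sum.cartesian_product by (simp only: case_prod_unfold)
    also have "\<dots> = (\<Sum>p\<in>P. of_bool (ballot n (fst p) (snd p)) * ((\<Prod>i\<in>fst p. x i) * (\<Prod>i\<in>snd p. x i)))"
      by (intro sum.mono_neutral_right) (auto simp: P_def)
    also have "\<dots> = (\<Sum>p\<in>P. (\<Prod>i\<in>fst p. x i) * (\<Prod>i\<in>snd p. x i))"
      by (intro sum.cong) (auto simp: P_def)
    finally show ?thesis by simp
  qed
  finally show ?thesis
    by (simp add: \<mu>_def)
qed

subsection \<open>Projection to one species\<close>

lemma finite_configs [simp]: "finite (configs m s)"
  by (simp add: configs_def)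

lemma configsD:
  assumes "\<eta> \<in> configs m s"
  shows "mset \<eta> = content m s" "length \<eta> = (\<Sum>r\<le>s. m r)"
proof -
  show *: "mset \<eta> = content m s"
    using assms by (simp add: configs_def permutations_of_multiset_def)
  have "length \<eta> = size (content m s)"
    by (simp flip: *)
  then show "length \<eta> = (\<Sum>r\<le>s. m r)"
    by (simp add: content_def size_multiset_sum)
qed

lemma count_content: "count (content m s) r = (if r \<le> s then m r else 0)"
  by (auto simp: content_def count_sum)

lemma size_filter_content: "size (filter_mset P (content m s)) = (\<Sum>r\<le>s. if P r then m r else 0)"
proof -
  have "filter_mset P (replicate_mset k r) = (if P r then replicate_mset k r else {#})" for k r
    by (induction k) auto
  then show ?thesis
    by (induction s) (auto simp: content_def)
qed

lemma vacancy_in_configs: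
  assumes "\<eta> \<in> configs m s" "m 0 \<ge> 1"
  shows "0 \<in> set \<eta>"
proof -
  have "count (mset \<eta>) 0 > 0"
    using assms by (simp add: configsD count_content del: count_mset)
  then show ?thesis
    by (simp only: count_greater_zero_iff set_mset_mset)
qed

lemma ring_bell_in_configs:
  assumes "\<eta> \<in> configs m s" "m 0 \<ge> 1" "j < length \<eta>"
  shows "ring_bell \<eta> j \<in> configs m s"
  using mset_ring_bell[OF assms(3) vacancy_in_configs[OF assms(1,2)]] assms(1)
  by (simp add: configs_def permutations_of_multiset_def)

lemma above_in_subsets_of_card:
  assumes "\<eta> \<in> configs m s"
  shows "above c \<eta> \<in> subsets_of_card (length \<eta>) (\<Sum>i=c..s. m i)"
proof -
  have "card (above c \<eta>) = length (filter ((\<le>) c) \<eta>)"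
    by (simp add: above_def length_filter_conv_card)
  also have "\<dots> = size (filter_mset ((\<le>) c) (mset \<eta>))"
    by (metis mset_filter size_mset)
  also have "\<dots> = (\<Sum>r\<le>s. if c \<le> r then m r else 0)"
    by (simp add: configsD[OF assms] size_filter_content)
  also have "\<dots> = (\<Sum>i=c..s. m i)"
    by (simp add: sum.If_cases) (intro sum.cong, auto)
  finally show ?thesis
    by (auto simp: subsets_of_card_def above_def)
qed

lemma expectation_configs:
  fixes f :: "nat list \<Rightarrow> real"
  assumes "set_pmf \<pi> \<subseteq> configs m s"
  shows "measure_pmf.expectation \<pi> f = (\<Sum>\<eta>\<in>configs m s. pmf \<pi> \<eta> * f \<eta>)"
  using assms by (subst integral_measure_pmf_real[of "configs m s"]) (auto simp: mult.commute)

text \<open>Stationarity tested against an observable \<open>f\<close>. Taking \<open>f\<close> to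
  be a function of a projection yields the balance equation of the projected process.\<close>

lemma stationary_generator:
  assumes "stationary m s x \<pi>" "m 0 \<ge> 1" "n = (\<Sum>r\<le>s. m r)"
  shows "(\<Sum>\<eta>\<in>configs m s. pmf \<pi> \<eta> * (\<Sum>j<n. 1 / x j * f (ring_bell \<eta> j))) =
    (\<Sum>\<eta>\<in>configs m s. pmf \<pi> \<eta> * f \<eta>) * (\<Sum>j<n. 1 / x j)"
proof -
  let ?C = "configs m s"
  have rate: "rate x \<xi> \<eta> = (\<Sum>j<n. 1 / x j * of_bool (ring_bell \<xi> j = \<eta>))" if "\<xi> \<in> ?C" for \<xi> \<eta>
  proof -
    have "{j. j < length \<xi> \<and> ring_bell \<xi> j = \<eta>} = {..<n} \<inter> {j. ring_bell \<xi> j = \<eta>}"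
      using configsD(2)[OF that] assms(3) by auto
    then show ?thesis
      unfolding rate_def by (simp add: sum.inter_restrict) (intro sum.cong refl, simp)
  qed
  have sum_bells: "(\<Sum>\<eta>\<in>?C. of_bool (ring_bell \<xi> j = \<eta>) * g \<eta>) = g (ring_bell \<xi> j)"
    if "\<xi> \<in> ?C" "j < n" for \<xi> j and g :: "nat list \<Rightarrow> real"
    using ring_bell_in_configs[OF that(1) assms(2)] that configsD(2)[OF that(1)] assms(3)
    by (simp add: of_bool_def if_distrib[of "\<lambda>a. a * _"] cong: if_cong)
  have total: "(\<Sum>\<eta>\<in>?C. rate x \<xi> \<eta>) = (\<Sum>j<n. 1 / x j)" if "\<xi> \<in> ?C" for \<xi>
  proof -
    have "(\<Sum>\<eta>\<in>?C. rate x \<xi> \<eta>) = (\<Sum>j<n. 1 / x j * (\<Sum>\<eta>\<in>?C. of_bool (ring_bell \<xi> j = \<eta>) * 1))"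
      unfolding rate[OF that] sum_distrib_left by (subst sum.swap) simp
    also have "\<dots> = (\<Sum>j<n. 1 / x j)"
      using that by (intro sum.cong refl) (simp only: sum_bells lessThan_iff)
    finally show ?thesis .
  qed
  \<comment> \<open>\<open>stationary\<close> omits self-transitions; adding them to both sides
    turns the outgoing rate into the total bell rate, the same in every state.\<close>
  have balance: "(\<Sum>\<xi>\<in>?C. pmf \<pi> \<xi> * rate x \<xi> \<eta>) = pmf \<pi> \<eta> * (\<Sum>j<n. 1 / x j)" if "\<eta> \<in> ?C" for \<eta>
    using assms(1) that unfolding total[OF that, symmetric] stationary_def
    by (simp add: sum.remove[of ?C \<eta>] distrib_left)
  have "(\<Sum>\<eta>\<in>?C. pmf \<pi> \<eta> * f \<eta>) * (\<Sum>j<n. 1 / x j) =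
      (\<Sum>\<eta>\<in>?C. (\<Sum>\<xi>\<in>?C. pmf \<pi> \<xi> * rate x \<xi> \<eta>) * f \<eta>)"
    unfolding sum_distrib_right[of _ _ "\<Sum>j<n. 1 / x j"] by (intro sum.cong refl) (simp add: balance)
  also have "\<dots> = (\<Sum>\<xi>\<in>?C. \<Sum>\<eta>\<in>?C. pmf \<pi> \<xi> * rate x \<xi> \<eta> * f \<eta>)"
    unfolding sum_distrib_right by (rule sum.swap)
  also have "\<dots> = (\<Sum>\<xi>\<in>?C. pmf \<pi> \<xi> * (\<Sum>j<n. 1 / x j * f (ring_bell \<xi> j)))"
  proof (intro sum.cong refl)
    fix \<xi> assume \<xi>: "\<xi> \<in> ?C"
    have "(\<Sum>\<eta>\<in>?C. pmf \<pi> \<xi> * rate x \<xi> \<eta> * f \<eta>) =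
        (\<Sum>\<eta>\<in>?C. \<Sum>j<n. pmf \<pi> \<xi> * (1 / x j * (of_bool (ring_bell \<xi> j = \<eta>) * f \<eta>)))"
      unfolding rate[OF \<xi>] sum_distrib_left sum_distrib_right by (simp only: mult.assoc)
    also have "\<dots> = (\<Sum>j<n. \<Sum>\<eta>\<in>?C. pmf \<pi> \<xi> * (1 / x j * (of_bool (ring_bell \<xi> j = \<eta>) * f \<eta>)))"
      by (rule sum.swap)
    also have "\<dots> = (\<Sum>j<n. pmf \<pi> \<xi> * (1 / x j * f (ring_bell \<xi> j)))"
      unfolding sum_distrib_left[symmetric] using \<xi>
      by (intro arg_cong[where f = "(*) _"] sum.cong refl) (simp only: sum_bells lessThan_iff)
    finally show "(\<Sum>\<eta>\<in>?C. pmf \<pi> \<xi> * rate x \<xi> \<eta> * f \<eta>) =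
        pmf \<pi> \<xi> * (\<Sum>j<n. 1 / x j * f (ring_bell \<xi> j))"
      by (simp only: sum_distrib_left)
  qed
  finally show ?thesis by simp
qed

section \<open>Law of the projected process\<close>

definition above_prob :: "nat \<Rightarrow> nat list pmf \<Rightarrow> (nat \<Rightarrow> nat) \<Rightarrow> nat \<Rightarrow> nat set \<Rightarrow> real" where
  "above_prob c \<pi> m s S = (\<Sum>\<eta>\<in>configs m s. pmf \<pi> \<eta> * of_bool (above c \<eta> = S))"

lemma sum_above_prob:
  assumes "n = (\<Sum>r\<le>s. m r)"
  shows "(\<Sum>\<eta>\<in>configs m s. pmf \<pi> \<eta> * h (above c \<eta>)) =
    (\<Sum>S\<in>subsets_of_card n (\<Sum>i=c..s. m i). above_prob c \<pi> m s S * h S)"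
proof -
  let ?A = "subsets_of_card n (\<Sum>i=c..s. m i)"
  have "(\<Sum>S\<in>?A. above_prob c \<pi> m s S * h S) =
      (\<Sum>\<eta>\<in>configs m s. \<Sum>S\<in>?A. pmf \<pi> \<eta> * of_bool (above c \<eta> = S) * h S)"
    unfolding above_prob_def sum_distrib_right by (rule sum.swap)
  also have "\<dots> = (\<Sum>\<eta>\<in>configs m s. pmf \<pi> \<eta> * h (above c \<eta>))"
  proof (intro sum.cong refl)
    fix \<eta> assume \<eta>: "\<eta> \<in> configs m s"
    then have "above c \<eta> \<in> ?A"
      using above_in_subsets_of_card[OF \<eta>, of c] configsD(2)[OF \<eta>] assms by simp
    then have "(\<Sum>S\<in>?A. if above c \<eta> = S then pmf \<pi> \<eta> * h S else 0) = pmf \<pi> \<eta> * h (above c \<eta>)"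
      by simp
    then show "(\<Sum>S\<in>?A. pmf \<pi> \<eta> * of_bool (above c \<eta> = S) * h S) = pmf \<pi> \<eta> * h (above c \<eta>)"
      by (simp add: of_bool_def if_distrib[of "\<lambda>a. a * _"] if_distrib[of "\<lambda>a. _ * a"] cong: if_cong)
  qed
  finally show ?thesis by simp
qed

lemma sum_above_less:
  fixes m :: "nat \<Rightarrow> nat"
  assumes "m 0 \<ge> 1" "0 < c"
  shows "(\<Sum>i=c..s. m i) < (\<Sum>r\<le>s. m r)"
proof -
  have "(\<Sum>i=c..s. m i) < (\<Sum>i\<in>insert 0 {c..s}. m i)"
    using assms by simp
  also have "\<dots> \<le> (\<Sum>r\<le>s. m r)"
    by (intro sum_mono2) auto
  finally show ?thesis .
qed

text \<open>With the indicator of \<open>above c \<eta> = T\<close> as test function,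
  \<open>stationary_generator\<close> and the lumping property say that the image law is balanced;
  uniqueness identifies it.\<close>

lemma above_prob_eq:
  assumes "n = (\<Sum>r\<le>s. m r)" "m 0 \<ge> 1" "\<And>i. i < n \<Longrightarrow> x i > 0" "stationary m s x \<pi>" "0 < c"
    and "S \<in> subsets_of_card n (\<Sum>i=c..s. m i)"
  shows "above_prob c \<pi> m s S = (\<Prod>i\<in>S. x i) / esym n x (\<Sum>i=c..s. m i)"
proof (rule balanced_unique)
  let ?A = "subsets_of_card n (\<Sum>i=c..s. m i)"
  have supp: "set_pmf \<pi> \<subseteq> configs m s"
    using assms(4) by (simp add: stationary_def)
  show "(\<Sum>i=c..s. m i) < n"
    using sum_above_less assms(1,2,5) by simp
  have "(\<Sum>S\<in>?A. above_prob c \<pi> m s S * 1) = (\<Sum>\<eta>\<in>configs m s. pmf \<pi> \<eta> * 1)"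
    using sum_above_prob[OF assms(1), of \<pi> "\<lambda>_. 1" c] by simp
  also have "\<dots> = 1"
    using sum_pmf_eq_1[OF finite_configs supp] by simp
  finally show "(\<Sum>S\<in>?A. above_prob c \<pi> m s S) = 1" by simp
  show "balanced n (\<Sum>i=c..s. m i) x (above_prob c \<pi> m s)"
    unfolding balanced_def
  proof
    fix T assume "T \<in> ?A"
    let ?h = "\<lambda>S. \<Sum>j<n. 1 / x j * of_bool (push n S j = T)"
    have "(\<Sum>S\<in>?A. \<Sum>j<n. above_prob c \<pi> m s S / x j * of_bool (push n S j = T)) =
        (\<Sum>S\<in>?A. above_prob c \<pi> m s S * ?h S)"
      by (simp add: sum_distrib_left)
    also have "\<dots> = (\<Sum>\<eta>\<in>configs m s. pmf \<pi> \<eta> * ?h (above c \<eta>))"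
      by (rule sum_above_prob[OF assms(1), symmetric])
    also have "\<dots> = (\<Sum>\<eta>\<in>configs m s. pmf \<pi> \<eta> *
        (\<Sum>j<n. 1 / x j * of_bool (above c (ring_bell \<eta> j) = T)))"
    proof (intro sum.cong refl arg_cong2[where f = "(*)"])
      fix \<eta> j assume "\<eta> \<in> configs m s" "j \<in> {..<n}"
      then show "of_bool (push n (above c \<eta>) j = T) = of_bool (above c (ring_bell \<eta> j) = T)"
        using above_ring_bell[of j \<eta> c] vacancy_in_configs[of \<eta> m s] configsD(2)[of \<eta> m s] assms(1,2,5)
        by simp
    qed
    also have "\<dots> = above_prob c \<pi> m s T * (\<Sum>j<n. 1 / x j)"
      unfolding above_prob_def by (rule stationary_generator[OF assms(4,2,1)])
    finally show "(\<Sum>S\<in>?A. \<Sum>j<n. above_prob c \<pi> m s S / x j * of_bool (push n S j = T)) =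
        above_prob c \<pi> m s T * (\<Sum>j<n. 1 / x j)" .
  qed
qed (use assms in auto)

section \<open>Currents\<close>

definition current_above :: "(nat \<Rightarrow> real) \<Rightarrow> nat list pmf \<Rightarrow> nat \<Rightarrow> nat \<Rightarrow> real" where
  "current_above x \<pi> c k =
     measure_pmf.expectation \<pi> (\<lambda>\<eta>. \<Sum>j<length \<eta>. 1 / x j * real (crossings_above \<eta> j c k))"

lemma current_eq_diff:
  assumes "set_pmf \<pi> \<subseteq> configs m s"
  shows "current x \<pi> r k = current_above x \<pi> r k - current_above x \<pi> (Suc r) k"
  unfolding current_def current_above_def expectation_configs[OF assms]
  by (simp add: crossings_eq_diff right_diff_distrib diff_divide_distrib sum_subtractf)

text \<open>Averaging \<open>crosses\<close> over the product law leaves the sum evaluated by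
  \<open>sum_crosses\<close>. The case 0, which occurs for \<open>c = s + 1\<close>, has no particle
  to count and corresponds to the convention that \<open>e\<close> vanishes at index -1.\<close>

lemma current_above_eq:
  assumes "n = (\<Sum>r\<le>s. m r)" "m 0 \<ge> 1" "\<And>i. i < n \<Longrightarrow> x i > 0" "stationary m s x \<pi>" "0 < c"
    and "k < n"
  shows "current_above x \<pi> c k = (case (\<Sum>i=c..s. m i) of 0 \<Rightarrow> 0 | Suc l \<Rightarrow> esym n x l / esym n x (Suc l))"
proof -
  let ?M = "\<Sum>i=c..s. m i"
  let ?A = "subsets_of_card n ?M"
  let ?h = "\<lambda>S. \<Sum>j<n. 1 / x j * of_bool (crosses n S j k)"
  have supp: "set_pmf \<pi> \<subseteq> configs m s"
    using assms(4) by (simp add: stationary_def)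
  have "current_above x \<pi> c k = (\<Sum>\<eta>\<in>configs m s. pmf \<pi> \<eta> * ?h (above c \<eta>))"
    unfolding current_above_def expectation_configs[OF supp]
  proof (intro sum.cong refl arg_cong2[where f = "(*)"])
    fix \<eta> j assume "\<eta> \<in> configs m s" "j \<in> {..<n}"
    then show "real (crossings_above \<eta> j c k) = of_bool (crosses n (above c \<eta>) j k)"
      using crossings_above_eq[of j \<eta> c k] vacancy_in_configs[of \<eta> m s] configsD(2)[of \<eta> m s] assms
      by simp
  qed (simp add: configsD(2) assms(1))
  also have "\<dots> = (\<Sum>S\<in>?A. above_prob c \<pi> m s S * ?h S)"
    by (rule sum_above_prob[OF assms(1)])
  also have "\<dots> = (\<Sum>S\<in>?A. (\<Prod>i\<in>S. x i) / esym n x ?M * ?h S)"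
    using above_prob_eq[OF assms(1-5)] by (intro sum.cong refl) simp
  also have "\<dots> = (\<Sum>S\<in>?A. \<Sum>j<n. (\<Prod>i\<in>S. x i) / x j * of_bool (crosses n S j k)) / esym n x ?M"
    by (simp add: sum_divide_distrib sum_distrib_left mult.commute)
  also have "\<dots> = (case ?M of 0 \<Rightarrow> 0 | Suc l \<Rightarrow> esym n x l / esym n x (Suc l))"
  proof (cases ?M)
    case 0
    have "\<not> crosses n {} j k" if "j < n" for j
      using that by (auto simp: crosses_def)
    then show ?thesis
      unfolding 0 by simp
  next
    case (Suc l)
    then have "l < n"
      using sum_above_less[of m c s] assms(1,2,5) by simp
    then show ?thesis
      unfolding Suc using sum_crosses[of n x l k] assms(3,6) \<open>l < n\<close> by simp
  qed
  finally show ?thesis .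
qed

theorem proposition19:
  fixes m M :: "nat \<Rightarrow> nat" and s n j k :: nat and x :: "nat \<Rightarrow> real" and \<pi> :: "nat list pmf"
  assumes "n = (\<Sum>r\<le>s. m r)"
    and "m 0 \<ge> 1"
    and "\<And>i. i < n \<Longrightarrow> x i > 0"
    and "\<And>r. M r = (\<Sum>i=r..s. m i)"
    and "stationary m s x \<pi>"
    and "1 \<le> j" and "j \<le> s" and "m j \<ge> 1"
    and "k < n"
  shows "current x \<pi> j k =
    schur n x (replicate (M (j + 1)) 2 @ replicate (m j - 1) 1) /
    (esym n x (M j) * esym n x (M (j + 1)))"
proof -
  \<comment> \<open>The length of the first column of the shape, which equals
    \<open>M j - 1\<close>.\<close>
  define a where "a = M (j + 1) + (m j - 1)"
  have Mj: "M j = Suc a"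
    using assms(4,7,8) by (simp add: a_def sum.atLeast_Suc_atMost)
  have "Suc a < n"
    using sum_above_less[of m j s] assms(1,2,4,6) Mj by simp
  have pos: "esym n x i > 0" if "i \<le> Suc a" for i
    using that \<open>Suc a < n\<close> by (intro esym_pos assms(3)) auto
  have cur: "current_above x \<pi> c k =
      (case M c of 0 \<Rightarrow> 0 | Suc l \<Rightarrow> esym n x l / esym n x (Suc l))" if "0 < c" for c
    using current_above_eq[OF assms(1-3,5) that assms(9)] assms(4) by simp
  have "current x \<pi> j k = current_above x \<pi> j k - current_above x \<pi> (j + 1) k"
    using current_eq_diff[of \<pi> m s x j k] assms(5) by (simp add: stationary_def)
  also have "\<dots> = ballot_sum n x a (M (j + 1)) / (esym n x (M j) * esym n x (M (j + 1)))"
  proof (cases "M (j + 1)")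
    \<comment> \<open>No higher species: the second current is 0 and the shape is a single column,
      whose sum is \<open>esym n x a\<close>.\<close>
    case 0
    then show ?thesis
      using cur[of j] cur[of "j + 1"] assms(6) Mj by (simp add: ballot_sum_0)
  next
    \<comment> \<open>Over the common denominator, \<open>esym n x a / esym n x (Suc a) - esym n x b
      / esym n x (Suc b)\<close> has the determinant of \<open>ballot_sum_eq\<close> as
      numerator.\<close>
    case (Suc b)
    then have "b \<le> a"
      by (simp add: a_def)
    then have "esym n x (Suc a) > 0" "esym n x (Suc b) > 0"
      using pos by auto
    then show ?thesis
      using cur[of j] cur[of "j + 1"] assms(6) Mj Suc \<open>b \<le> a\<close>
      by (simp add: ballot_sum_eq field_simps)
  qed
  finally show ?thesis
    by (simp only: schur_two_columns a_def)
qed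

end
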